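(* Let $\ell\in\mathbb{N}_0$, let $\mu\geq2\ell+1$ be an odd integer, $j\in\mathbb{N}_0$ and $x>0$. Then $$\int_0^\infty G^{20}_{04}\!\left((xy)^2\,\Big|\,0,-\ell-\tfrac12,-\tfrac\mu2,-\ell-\tfrac{\mu+1}{2}\right)e^{-2y}y^{\mu+1}M_j^{\mu,\ell}(4y)\,dy=\frac{(-1)^j}{2}e^{-2x}x^{-(2\ell+1)}M_j^{\mu,\ell}(4x).$$
   Context: $G^{20}_{04}(z\,|\,b_1,b_2,b_3,b_4)$ is Meijer's $G$-function, $G^{20}_{04}(z|b_1,b_2,b_3,b_4)=\frac{1}{2\pi i}\int_L\frac{\Gamma(b_1-s)\Gamma(b_2-s)}{\Gamma(1-b_3+s)\Gamma(1-b_4+s)}z^s\,ds$ with the standard contour $L$. Let $I_\alpha$, $K_\alpha$ be the modified Bessel functions and set $\widetilde I_\alpha(z)=(z/2)^{-\alpha}I_\alpha(z)$, $\widetilde K_\alpha(z)=(z/2)^{-\alpha}K_\alpha(z)$. For $\mu\in\mathbb{C}$, $\ell\in\mathbb{N}_0$, $x>0$ and $t$ near $0$ define $$G^{\mu,\ell}(t,x)=\frac{1}{(1-t)^{\ell+\frac{\mu+3}{2}}}\left(\frac x2\right)^{2\ell+1}e^{\frac x2}\,\widetilde I_{\frac\mu2}\!\left(\frac{tx}{2(1-t)}\right)\widetilde K_{\ell+\frac12}\!\left(\frac{x}{2(1-t)}\right),$$ and $M_j^{\mu,\ell}(x)=\frac{\Gamma(j+\mu+1)}{j!\,2^\mu\,\Gamma(j+\frac{\mu+1}{2})}\left.\frac{\partial^j}{\partial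 t^j}\right|_{t=0}G^{\mu,\ell}(t,x)$ (a polynomial in $x$). *)

theory Defs
  imports "HOL-Analysis.Analysis"
begin

text \<open>Normalised modified Bessel function of the first kind,
  \<open>Itilde a z = (z/2)^(-a) I_a(z) = \<Sum>k. (z/2)^(2k) / (k! Gamma(k+a+1))\<close>.
  Written as its (entire, even) power series so that it also makes sense
  for \<open>z \<le> 0\<close>; \<open>1/Gamma\<close> is the library's entire function \<open>rGamma\<close>.\<close>
definition besselI_tilde :: "real \<Rightarrow> real \<Rightarrow> real" where
  "besselI_tilde a z = (\<Sum>k. (z/2) ^ (2*k) * rGamma (real k + a + 1) / fact k)"

definition besselI :: "real \<Rightarrow> real \<Rightarrow> real" where
  "besselI a z = (z/2) powr a * besselI_tilde a z"

text \<open>Modified Bessel function of the second kind (Macdonald function), for \<open>z > 0\<close>,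
  via the standard integral representation \<open>K_a(z) = \<integral>_0^\<infinity> exp(-z cosh t) cosh(a t) dt\<close>.\<close>
definition besselK :: "real \<Rightarrow> real \<Rightarrow> real" where
  "besselK a z = (LINT t:{0..}|lborel. exp (- z * cosh t) * cosh (a * t))"

definition besselK_tilde :: "real \<Rightarrow> real \<Rightarrow> real" where
  "besselK_tilde a z = (z/2) powr (- a) * besselK a z"

text \<open>Mellin--Barnes integral
  \<open>(1/(2\<pi>i)) \<integral>_L Gamma(b1-s) Gamma(b2-s) / (Gamma(1-b3+s) Gamma(1-b4+s)) z^s ds\<close>
  for real \<open>z > 0\<close>, with \<open>L\<close> the vertical line \<open>Re s = c\<close>, traversed upwards.
  The line must separate the poles of \<open>Gamma(b1-s)Gamma(b2-s)\<close> (to its right) and the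
  integral must converge absolutely, i.e. \<open>(b1+b2+b3+b4-1)/4 < c < min b1 b2\<close>; we take
  the midpoint of this interval (the value does not depend on the choice of \<open>c\<close>).\<close>
definition meijerG20_04_line :: "real \<Rightarrow> real \<Rightarrow> real \<Rightarrow> real \<Rightarrow> real \<Rightarrow> real \<Rightarrow> complex" where
  "meijerG20_04_line c z b1 b2 b3 b4 =
     (LINT t|lborel.
        (let s = Complex c t in
           Gamma (complex_of_real b1 - s) * Gamma (complex_of_real b2 - s)
           * rGamma (1 - complex_of_real b3 + s) * rGamma (1 - complex_of_real b4 + s)
           * (complex_of_real z) powr s)) / complex_of_real (2 * pi)"

definition meijerG20_04 :: "real \<Rightarrow> real \<Rightarrow> real \<Rightarrow> real \<Rightarrow> real \<Rightarrow> complex" where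
  "meijerG20_04 z b1 b2 b3 b4 =
     meijerG20_04_line ((min b1 b2 + (b1 + b2 + b3 + b4 - 1) / 4) / 2) z b1 b2 b3 b4"

definition Gen :: "real \<Rightarrow> nat \<Rightarrow> real \<Rightarrow> real \<Rightarrow> real" where
  "Gen mu l t x =
     1 / (1 - t) powr (real l + (mu + 3) / 2) * (x / 2) ^ (2 * l + 1) * exp (x / 2)
     * besselI_tilde (mu / 2) (t * x / (2 * (1 - t)))
     * besselK_tilde (real l + 1 / 2) (x / (2 * (1 - t)))"

definition Mpoly :: "nat \<Rightarrow> real \<Rightarrow> nat \<Rightarrow> real \<Rightarrow> real" where
  "Mpoly j mu l x =
     Gamma (real j + mu + 1) / (fact j * 2 powr mu * Gamma (real j + (mu + 1) / 2))
     * (deriv ^^ j) (\<lambda>t. Gen mu l t x) 0"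

end

theory Submission
  imports Defs "HOL-Probability.Probability" "HOL-Complex_Analysis.Laurent_Convergence"
begin

text \<open>
  Put \<open>w = 2s + \<mu> + 2\<close> and \<open>w' = -2s - 2l - 1\<close>. Legendre duplication turns the Mellin--Barnes
  kernel into \<open>((w'+1)/2)_l / ((w+1)/2)_l * 2^(w-w') * Gamma w' / Gamma w\<close>. On the other side,
  \<open>e^(-2y) y^(\<mu>+1) M_j(4y)\<close> has Mellin transform \<open>2^(-w) Gamma w * P w\<close>, where \<open>P\<close> arises from the
  polynomial \<open>M_j\<close> by replacing powers by Pochhammer symbols in \<open>w\<close>. The generating function of these
  \<open>P\<close> is \<open>((w+1)/2)_l (1-t)^(w-g) 2F1(w/2, (w+1)/2+l; \<mu>/2+1; t^2)\<close> up to a constant, with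
  \<open>g = (\<mu>+1)/2 - l = (w+w')/2\<close>, so Euler's transformation exchanges \<open>w\<close> and \<open>w'\<close> at the cost of
  \<open>t \<mapsto> -t\<close>. Hence kernel times Mellin transform equals \<open>(-1)^j 2^(-w') Gamma w' * P w'\<close>, and Mellin
  inversion of \<open>Gamma w'\<close> gives the right-hand side.
  The interchange of integrals needs \<open>|Gamma z / Gamma (z + 3/2)| = O(|z|^(-3/2))\<close> on vertical lines.
\<close>

section \<open>Euler's transformation for formal power series\<close>

text \<open>\<open>gen_coeff\<close> takes an arbitrary sequence \<open>f\<close> in place of
  powers, so one finite double sum yields both the polynomial (real powers) and its Mellin transform
  (complex Pochhammer symbols). The symmetry between \<open>w\<close> and \<open>w'\<close> can
  therefore be proved formally, for power series in \<open>t\<close> with \<open>w\<close> as a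
  parameter: no convergence of a generating function and no interchange of the sum over
  \<open>j\<close> with an integral has to be discussed. Analysis enters only for a fixed
  \<open>j\<close>.

  The contour in the definition of the G-function is the midpoint line. On it the real parts of
  \<open>w\<close> and \<open>w'\<close> are positive and differ by \<open>3/2 + N\<close>, where
  \<open>mu = 2*l + 1 + 2*N\<close>. Here the oddness of \<open>mu\<close> and its lower bound
  enter: \<open>N\<close> is a natural number, so the Gamma quotient decays at least with exponent
  3/2, which exceeds 1. The half in 3/2 is the delicate part, since the functional equation of Gamma
  only gives whole steps; it is obtained from Euler's product.\<close>

text \<open>The expansion of \<open>(1 - X)^(-b)\<close>.\<close>

definition negbinom_fps :: "'a::field_char_0 \<Rightarrow> 'a fps" where
  "negbinom_fps b = Abs_fps (\<lambda>n. pochhammer b n / fact n)"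

lemma negbinom_fps_nth [simp]: "fps_nth (negbinom_fps b) n = pochhammer b n / fact n"
  by (simp add: negbinom_fps_def)

text \<open>Coefficientwise this exponent law is the Chu-Vandermonde convolution, so it holds for
  arbitrary parameters with no convergence involved.\<close>

lemma negbinom_fps_add: "negbinom_fps (a + b) = negbinom_fps a * negbinom_fps b"
proof (rule fps_ext)
  fix n
  have "fps_nth (negbinom_fps (a + b)) n = (\<Sum>k\<le>n. of_nat (n choose k) * pochhammer a k * pochhammer b (n - k)) / fact n"
    by (simp add: pochhammer_binomial_sum)
  also have "\<dots> = (\<Sum>k\<le>n. pochhammer a k / fact k * (pochhammer b (n - k) / fact (n - k)))"
    unfolding sum_divide_distrib by (intro sum.cong) (auto simp: binomial_fact field_simps)
  finally show "fps_nth (negbinom_fps (a + b)) n = fps_nth (negbinom_fps a * negbinom_fps b) n"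
    by (simp add: fps_mult_nth atMost_atLeast0)
qed

lemma negbinom_fps_0 [simp]: "negbinom_fps 0 = 1"
  by (rule fps_ext) (auto simp: pochhammer_0_left)

lemma negbinom_fps_deriv: "(1 - fps_X) * fps_deriv (negbinom_fps b) = fps_const b * negbinom_fps b"
proof (rule fps_ext)
  fix n
  show "fps_nth ((1 - fps_X) * fps_deriv (negbinom_fps b)) n = fps_nth (fps_const b * negbinom_fps b) n"
    by (cases n) (auto simp: algebra_simps pochhammer_Suc divide_simps simp del: of_nat_Suc)
qed

definition gauss_hyp_fps :: "'a::field_char_0 \<Rightarrow> 'a \<Rightarrow> 'a \<Rightarrow> 'a fps" where
  "gauss_hyp_fps a b c = Abs_fps (\<lambda>n. pochhammer a n * pochhammer b n / (fact n * pochhammer c n))"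

lemma gauss_hyp_fps_nth [simp]:
  "fps_nth (gauss_hyp_fps a b c) n = pochhammer a n * pochhammer b n / (fact n * pochhammer c n)"
  by (simp add: gauss_hyp_fps_def)

text \<open>The operator \<open>X * d/dX\<close> multiplies coefficient \<open>n\<close> by
  \<open>n\<close>, which turns Gauss's equation into a two-term recurrence. Existence and
  uniqueness of the power series solution both become statements about this recurrence.\<close>

lemma hypergeometric_ode_iff:
  fixes f :: "'a::field_char_0 fps"
  shows "fps_X * (1 - fps_X) * fps_deriv (fps_deriv f)
           + (fps_const c - fps_const (a + b + 1) * fps_X) * fps_deriv f = fps_const (a * b) * f
     \<longleftrightarrow> (\<forall>n. of_nat (Suc n) * (of_nat n + c) * fps_nth f (Suc n) = (of_nat n + a) * (of_nat n + b) * fps_nth f n)"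
  (is "?L = ?R \<longleftrightarrow> _")
proof -
  have 1: "fps_nth (fps_X * fps_deriv (fps_deriv f)) n = of_nat n * of_nat (Suc n) * fps_nth f (Suc n)" for n
    by (cases n) (auto simp del: of_nat_Suc)
  have 2: "fps_nth (fps_X * (fps_X * fps_deriv (fps_deriv f))) n = of_nat n * (of_nat n - 1) * fps_nth f n" for n
    by (cases n) (auto simp: 1)
  have 3: "fps_nth (fps_X * fps_deriv f) n = of_nat n * fps_nth f n" for n
    by (cases n) (auto)
  have "?L = fps_X * fps_deriv (fps_deriv f) - fps_X * (fps_X * fps_deriv (fps_deriv f))
          + (fps_const c * fps_deriv f - fps_const (a + b + 1) * (fps_X * fps_deriv f))"
    by (simp add: algebra_simps)
  then have "fps_nth ?L n - fps_nth ?R n =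
      of_nat (Suc n) * (of_nat n + c) * fps_nth f (Suc n) - (of_nat n + a) * (of_nat n + b) * fps_nth f n" for n
    by (simp only: fps_add_nth fps_sub_nth 1 2 3 fps_mult_left_const_nth fps_deriv_nth) (simp add: algebra_simps)
  then show ?thesis
    unfolding fps_eq_iff by (metis eq_iff_diff_eq_0)
qed

lemma gauss_hyp_fps_ode:
  assumes "\<And>n. c + of_nat n \<noteq> 0"
  shows "fps_X * (1 - fps_X) * fps_deriv (fps_deriv (gauss_hyp_fps a b c))
           + (fps_const c - fps_const (a + b + 1) * fps_X) * fps_deriv (gauss_hyp_fps a b c)
         = fps_const (a * b) * gauss_hyp_fps a b c"
  unfolding hypergeometric_ode_iff
proof
  fix n
  have "pochhammer c n \<noteq> 0"
    using assms by (auto simp: pochhammer_eq_0_iff) (metis add.right_inverse)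
  then show "of_nat (Suc n) * (of_nat n + c) * fps_nth (gauss_hyp_fps a b c) (Suc n) =
        (of_nat n + a) * (of_nat n + b) * fps_nth (gauss_hyp_fps a b c) n"
    using assms[of n] by (simp add: pochhammer_Suc divide_simps add.commute del: of_nat_Suc)
qed

text \<open>The factor \<open>(n + 1) * (n + c)\<close> in front of coefficient \<open>n + 1\<close>
  never vanishes, so the recurrence propagates the constant term. The equation is of second order,
  but \<open>0\<close> is a singular point, which leaves only one initial value free.\<close>

lemma gauss_hyp_fps_unique:
  assumes c: "\<And>n. c + of_nat n \<noteq> 0" and f0: "fps_nth f 0 = 1"
  assumes ode: "fps_X * (1 - fps_X) * fps_deriv (fps_deriv f)
           + (fps_const c - fps_const (a + b + 1) * fps_X) * fps_deriv f = fps_const (a * b) * f"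
  shows "f = gauss_hyp_fps a b c"
proof (rule fps_ext)
  fix n
  have rec: "of_nat (Suc n) * (of_nat n + c) * fps_nth f (Suc n) = (of_nat n + a) * (of_nat n + b) * fps_nth f n" for n
    using ode unfolding hypergeometric_ode_iff by blast
  have rec': "of_nat (Suc n) * (of_nat n + c) * fps_nth (gauss_hyp_fps a b c) (Suc n)
      = (of_nat n + a) * (of_nat n + b) * fps_nth (gauss_hyp_fps a b c) n" for n
    using gauss_hyp_fps_ode[OF c] unfolding hypergeometric_ode_iff by blast
  show "fps_nth f n = fps_nth (gauss_hyp_fps a b c) n"
  proof (induction n)
    case (Suc n)
    have "of_nat (Suc n) * (of_nat n + c) \<noteq> 0"
      using c[of n] by (simp add: add.commute del: of_nat_Suc)
    then show ?case using rec[of n] rec'[of n] Suc.IH by (metis mult_left_cancel)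
  qed (simp add: f0)
qed

text \<open>Both sides solve the hypergeometric equation, whose power series solution is determined by its
  constant term.\<close>

theorem euler_transformation_fps:
  assumes c: "\<And>n. c + of_nat n \<noteq> 0"
  shows "gauss_hyp_fps a b c = negbinom_fps (a + b - c) * gauss_hyp_fps (c - a) (c - b) c"
proof -
  define s where "s = a + b - c"
  define B where "B = negbinom_fps s"
  define f where "f = gauss_hyp_fps (c - a) (c - b) c"
  define X :: "'a fps" where "X = fps_X"
  define D where "D = (1 - X)"
  define f1 where "f1 = fps_deriv f"
  define f2 where "f2 = fps_deriv f1"
  define S where "S = fps_const s"
  define g where "g = B * f"
  \<comment> \<open>\<open>B\<close> stands for \<open>(1 - X)^(-s)\<close>; each differentiation
    costs a factor \<open>D\<close> in the denominator, so the derivatives of \<open>g\<close> are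
    handled only after multiplication by \<open>D\<close> and \<open>D^2\<close>.\<close>
  have DB: "D * fps_deriv B = S * B"
    unfolding D_def X_def S_def B_def by (rule negbinom_fps_deriv)
  have "fps_deriv g = B * f1 + fps_deriv B * f"
    unfolding g_def f1_def by simp
  then have "D * fps_deriv g = B * (D * f1) + D * fps_deriv B * f"
    by (simp add: algebra_simps)
  then have Dg: "D * fps_deriv g = B * (D * f1 + S * f)"
    unfolding DB by (simp add: algebra_simps)
  have "D * (D * fps_deriv (fps_deriv g)) = D * (fps_deriv (D * fps_deriv g) + fps_deriv g)"
    by (simp add: D_def X_def algebra_simps)
  also have "\<dots> = D * fps_deriv (B * (D * f1 + S * f)) + D * fps_deriv g"
    by (simp only: Dg distrib_left)
  also have "fps_deriv (B * (D * f1 + S * f)) = B * (D * f2 - f1 + S * f1) + fps_deriv B * (D * f1 + S * f)"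
    by (simp add: D_def X_def S_def f1_def f2_def algebra_simps)
  finally have DDg: "D * (D * fps_deriv (fps_deriv g)) = B * (D * D * f2 + 2 * S * D * f1 + S * (S + 1) * f)"
    using DB Dg by algebra
  define A B' C where "A = fps_const a" and "B' = fps_const b" and "C = fps_const c"
  have S: "S = A + B' - C" by (simp add: S_def s_def A_def B'_def C_def)
  have odef: "X * D * f2 + (C - (2 * C - A - B' + 1) * X) * f1 = (C - A) * (C - B') * f"
  proof -
    have "fps_const ((c - a) + (c - b) + 1) = 2 * C - A - B' + 1"
      by (simp add: A_def B'_def C_def algebra_simps numeral_fps_const flip: fps_const_1_eq_1)
    moreover have "fps_const ((c - a) * (c - b)) = (C - A) * (C - B')"
      by (simp add: A_def B'_def C_def)
    ultimately show ?thesis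
      using gauss_hyp_fps_ode[OF c, where a = "c - a" and b = "c - b"]
      unfolding f2_def f1_def f_def X_def D_def C_def[symmetric] by simp
  qed
  \<comment> \<open>With this extra factor the equation for \<open>g\<close> becomes
    \<open>B * D\<close> times the equation \<open>odef\<close> for \<open>f\<close>. The factor
    \<open>D\<close> is cancelled at the end, power series over a field having no zero
    divisors.\<close>
  have "D * (X * D * fps_deriv (fps_deriv g) + (C - (A + B' + 1) * X) * fps_deriv g)
      = X * (D * (D * fps_deriv (fps_deriv g))) + (C - (A + B' + 1) * X) * (D * fps_deriv g)"
    by (simp add: algebra_simps)
  also have "\<dots> = X * (B * (D * D * f2 + 2 * S * D * f1 + S * (S + 1) * f)) + (C - (A + B' + 1) * X) * (B * (D * f1 + S * f))"
    unfolding DDg Dg ..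
  also have "\<dots> = D * (A * B' * g)"
    using odef unfolding g_def S D_def by algebra
  finally have "X * D * fps_deriv (fps_deriv g) + (C - (A + B' + 1) * X) * fps_deriv g = A * B' * g"
    by (simp add: D_def X_def fps_X_neq_one[symmetric] del: fps_X_neq_one)
  moreover have "A + B' + 1 = fps_const (a + b + 1)" "A * B' = fps_const (a * b)"
    by (simp_all add: A_def B'_def flip: fps_const_1_eq_1)
  ultimately have "g = gauss_hyp_fps a b c"
    by (intro gauss_hyp_fps_unique c) (auto simp: X_def D_def C_def g_def B_def f_def)
  then show ?thesis by (simp add: g_def B_def f_def s_def)
qed

text \<open>Reflection rewrites (b+i)_(m-i) as a sign times (1-b-m)_(m-i); the signs combine to
  (-1)^m and the ordinary Vandermonde convolution remains. The identity serves to absorb the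
  exponential series in \<open>gen_coeff_pochhammer\<close>.\<close>

lemma pochhammer_vandermonde_alternating:
  fixes a b :: "'a::field_char_0"
  shows "(\<Sum>i\<le>m. (-1) ^ i / fact i * pochhammer a i * (pochhammer (b + of_nat i) (m - i) / fact (m - i)))
         = pochhammer (b - a) m / fact m"
proof -
  have *: "pochhammer (b + of_nat i) (m - i) = (-1) ^ (m - i) * pochhammer (1 - b - of_nat m) (m - i)" if "i \<le> m" for i
  proof -
    have "pochhammer (1 - b - of_nat m) (m - i) = (-1) ^ (m - i) * pochhammer (b + of_nat m - 1 - of_nat (m - i) + 1) (m - i)"
      using pochhammer_minus[of "b + of_nat m - 1" "m - i"] by (simp add: algebra_simps)
    also have "b + of_nat m - 1 - of_nat (m - i) + 1 = b + of_nat i"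
      using that by (simp add: of_nat_diff)
    finally show ?thesis by simp
  qed
  have "(\<Sum>i\<le>m. (-1) ^ i / fact i * pochhammer a i * (pochhammer (b + of_nat i) (m - i) / fact (m - i)))
      = (-1) ^ m * (\<Sum>i\<le>m. of_nat (m choose i) * pochhammer a i * pochhammer (1 - b - of_nat m) (m - i)) / fact m"
    unfolding sum_distrib_left sum_divide_distrib
  proof (intro sum.cong refl)
    fix i assume "i \<in> {..m}"
    then have i: "i \<le> m" by simp
    have "(-1::'a) ^ i * (-1) ^ (m - i) = (-1) ^ m"
      using i by (simp flip: power_add)
    then show "(-1) ^ i / fact i * pochhammer a i * (pochhammer (b + of_nat i) (m - i) / fact (m - i)) =
       (-1) ^ m * (of_nat (m choose i) * pochhammer a i * pochhammer (1 - b - of_nat m) (m - i)) / fact m"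
      unfolding *[OF i] by (simp add: binomial_fact i divide_simps) 
  qed
  also have "\<dots> = (-1) ^ m * pochhammer (a + (1 - b - of_nat m)) m / fact m"
    by (simp only: pochhammer_binomial_sum)
  also have "a + (1 - b - of_nat m) = -(b - a + of_nat m - 1)" by simp
  also have "(-1) ^ m * pochhammer (-(b - a + of_nat m - 1)) m = pochhammer (b - a) m"
    unfolding pochhammer_minus by simp
  finally show ?thesis .
qed

section \<open>A functional equation for the generating function\<close>

text \<open>This is (1-X^2)^(-b) = (1-X)^(-b) (1+X)^(-b) for an arbitrary exponent: both sides solve
  (1-X^2) y' = 2 b X y and have constant term 1.\<close>

lemma negbinom_fps_compose_square:
  "negbinom_fps b oo fps_X ^ 2 = negbinom_fps b * (negbinom_fps b oo (fps_const (-1) * fps_X))"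
    (is "?p = ?q")
proof -
  define N where "N = negbinom_fps b"
  define r where "r = N oo (fps_const (-1) * fps_X)"
  have N: "(1 - fps_X) * fps_deriv N = fps_const b * N"
    unfolding N_def by (rule negbinom_fps_deriv)
  have "((1 - fps_X) * fps_deriv N) oo fps_X ^ 2 = (fps_const b * N) oo fps_X ^ 2"
    by (simp only: N)
  then have A: "(1 - fps_X ^ 2) * (fps_deriv N oo fps_X ^ 2) = fps_const b * ?p"
    by (simp add: fps_compose_mult_distrib fps_compose_sub_distrib N_def fps_X_fps_compose_startby0)
  have "fps_deriv ?p = (fps_deriv N oo fps_X ^ 2) * (2 * fps_X)"
    by (subst fps_compose_deriv) (simp_all add: N_def fps_deriv_power numeral_fps_const)
  then have "(1 - fps_X ^ 2) * fps_deriv ?p = 2 * fps_X * ((1 - fps_X ^ 2) * (fps_deriv N oo fps_X ^ 2))"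
    by (simp add: algebra_simps)
  then have p: "(1 - fps_X ^ 2) * fps_deriv ?p = fps_const (2 * b) * (fps_X * ?p)"
    unfolding A by (simp add: algebra_simps flip: numeral_fps_const fps_const_mult)
  have "((1 - fps_X) * fps_deriv N) oo (fps_const (-1) * fps_X) = (fps_const b * N) oo (fps_const (-1) * fps_X)"
    by (simp only: N)
  then have "(1 + fps_X) * (fps_deriv N oo (fps_const (-1) * fps_X)) = fps_const b * r"
    by (simp add: fps_compose_mult_distrib fps_compose_sub_distrib r_def fps_X_fps_compose_startby0
        flip: fps_const_neg)
  moreover have "fps_deriv r = - (fps_deriv N oo (fps_const (-1) * fps_X))"
    unfolding r_def by (subst fps_compose_deriv) (simp_all flip: fps_const_neg)
  ultimately have r: "(1 + fps_X) * fps_deriv r = - (fps_const b * r)"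
    by (simp add: algebra_simps)
  have "(1 - fps_X ^ 2) * fps_deriv (N * r)
      = (1 - fps_X) * N * ((1 + fps_X) * fps_deriv r) + (1 + fps_X) * r * ((1 - fps_X) * fps_deriv N)"
    by (simp add: algebra_simps power2_eq_square)
  also have "\<dots> = fps_const (2 * b) * (fps_X * (N * r))"
    unfolding r N by (simp add: algebra_simps flip: fps_const_mult numeral_fps_const)
  finally have q: "(1 - fps_X ^ 2) * fps_deriv ?q = fps_const (2 * b) * (fps_X * ?q)"
    unfolding N_def r_def .
  define d where "d = ?p - ?q"
  have "(1 - fps_X ^ 2) * fps_deriv d = fps_const (2 * b) * (fps_X * d)"
    unfolding d_def fps_deriv_sub right_diff_distrib p q ..
  then have d: "fps_deriv d = fps_X ^ 2 * fps_deriv d + fps_const (2 * b) * (fps_X * d)"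
    by (simp add: algebra_simps)
  \<comment> \<open>The equation forces coefficient 1 to vanish and ties coefficient
    \<open>n\<close> to coefficient \<open>n - 2\<close> otherwise, hence the strong
    induction.\<close>
  have "fps_nth d n = 0" for n
  proof (induction n rule: less_induct)
    case (less n)
    show ?case
    proof (cases n)
      case 0
      then show ?thesis by (simp add: d_def)
    next
      case (Suc m)
      have "of_nat (Suc m) * fps_nth d (Suc m) = fps_nth (fps_X ^ 2 * fps_deriv d) m + 2 * b * fps_nth (fps_X * d) m"
        using arg_cong[OF d, of "\<lambda>f. fps_nth f m"] by simp
      also have "\<dots> = 0"
        using less.IH Suc by (simp add: fps_X_power_mult_nth)
      finally show ?thesis unfolding Suc by (simp del: of_nat_Suc)
    qed
  qed
  then have "d = 0" by (intro fps_ext) simp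
  then show ?thesis by (simp add: d_def)
qed

text \<open>Coefficients of the reverse Bessel polynomials \<open>\<theta>_l\<close>, for which
  \<open>K_(l+1/2)(z) = sqrt(pi/(2z)) e^(-z) z^(-l) \<theta>_l(z)\<close>.\<close>

fun bessel_theta :: "nat \<Rightarrow> nat \<Rightarrow> nat" where
  "bessel_theta 0 q = (if q = 0 then 1 else 0)"
| "bessel_theta (Suc 0) q = (if q \<le> 1 then 1 else 0)"
| "bessel_theta (Suc (Suc l)) q =
     (if 2 \<le> q then bessel_theta l (q - 2) else 0) + (2 * l + 3) * bessel_theta (Suc l) q"

lemma bessel_theta_eq_0: "l < q \<Longrightarrow> bessel_theta l q = 0"
  by (induction l q rule: bessel_theta.induct) auto

text \<open>The three-term recurrence of the reverse Bessel polynomials with \<open>f q\<close> in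
  place of the power \<open>z^q\<close>. It is needed for powers (Macdonald functions) and for
  Pochhammer symbols (Mellin transforms).\<close>

lemma sum_bessel_theta_Suc_Suc:
  fixes f :: "nat \<Rightarrow> 'a::comm_semiring_1"
  shows "(\<Sum>q\<le>Suc (Suc l). of_nat (bessel_theta (Suc (Suc l)) q) * f q) =
         (\<Sum>q\<le>l. of_nat (bessel_theta l q) * f (q + 2))
         + of_nat (2 * l + 3) * (\<Sum>q\<le>Suc l. of_nat (bessel_theta (Suc l) q) * f q)"
proof -
  have "(\<Sum>q\<le>Suc (Suc l). of_nat (bessel_theta (Suc (Suc l)) q) * f q) =
      (\<Sum>q\<le>Suc (Suc l). of_nat (if 2 \<le> q then bessel_theta l (q - 2) else 0) * f q)
      + of_nat (2 * l + 3) * (\<Sum>q\<le>Suc (Suc l). of_nat (bessel_theta (Suc l) q) * f q)"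
    unfolding sum_distrib_left sum.distrib[symmetric]
    by (intro sum.cong) (simp_all add: algebra_simps del: of_nat_Suc)
  also have "(\<Sum>q\<le>Suc (Suc l). of_nat (if 2 \<le> q then bessel_theta l (q - 2) else 0) * f q)
      = (\<Sum>q\<le>l. of_nat (bessel_theta l q) * f (q + 2))"
    by (simp only: sum.atMost_Suc_shift) simp
  also have "(\<Sum>q\<le>Suc (Suc l). of_nat (bessel_theta (Suc l) q) * f q)
      = (\<Sum>q\<le>Suc l. of_nat (bessel_theta (Suc l) q) * f q)"
    by (simp add: bessel_theta_eq_0)
  finally show ?thesis .
qed

text \<open>Analytically, the left side is the Mellin transform of exp(-z) theta_l(z) at
  \<open>u\<close>, divided by \<open>Gamma u\<close>. It factorises because the Mellin transform of
  a Macdonald function is a product of two Gamma factors. The hypergeometric parameter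
  \<open>(w + 1) / 2 + l\<close> originates here.\<close>

lemma sum_bessel_theta_pochhammer:
  fixes u :: "'a::field_char_0"
  shows "(\<Sum>q\<le>l. of_nat (bessel_theta l q) * pochhammer u q) = 2 ^ l * pochhammer ((u + 1) / 2) l"
proof (induction l arbitrary: u rule: induct_nat_012)
  case (ge2 l)
  have "(\<Sum>q\<le>l. of_nat (bessel_theta l q) * pochhammer u (q + 2))
      = u * (u + 1) * (\<Sum>q\<le>l. of_nat (bessel_theta l q) * pochhammer (u + 2) q)"
    unfolding sum_distrib_left by (intro sum.cong) (simp_all add: pochhammer_rec algebra_simps)
  also have "\<dots> = u * (u + 1) * (2 ^ l * pochhammer ((u + 1) / 2 + 1) l)"
    by (simp add: ge2.IH(1) add_divide_distrib)
  finally have "(\<Sum>q\<le>Suc (Suc l). of_nat (bessel_theta (Suc (Suc l)) q) * pochhammer u q)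
      = (u + 1) * 2 ^ l * pochhammer ((u + 1) / 2 + 1) l * (u + of_nat (2 * l + 3))"
    unfolding sum_bessel_theta_Suc_Suc ge2.IH(2) pochhammer_rec[of _ l]
    by (simp add: algebra_simps)
  also have "\<dots> = 2 ^ Suc (Suc l) * ((u + 1) / 2 * (pochhammer ((u + 1) / 2 + 1) l * ((u + 1) / 2 + 1 + of_nat l)))"
    by (simp add: field_simps)
  also have "(u + 1) / 2 * (pochhammer ((u + 1) / 2 + 1) l * ((u + 1) / 2 + 1 + of_nat l)) = pochhammer ((u + 1) / 2) (Suc (Suc l))"
    by (simp only: pochhammer_rec[of _ "Suc l"] pochhammer_Suc[of _ l])
  finally show ?case .
qed (simp_all add: field_simps)

text \<open>With \<open>f k = Y^k\<close> this is, up to a constant, the coefficient of \<open>t^j\<close> in \<open>Gen mu l t (2*Y)\<close>; with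
  \<open>f = pochhammer w\<close> it is the Mellin transform of that coefficient against \<open>e^(-Y) / Gamma w\<close>.\<close>

definition gen_coeff :: "nat \<Rightarrow> (nat \<Rightarrow> 'a) \<Rightarrow> 'a \<Rightarrow> nat \<Rightarrow> (nat \<Rightarrow> 'a) \<Rightarrow> 'a::field_char_0" where
  "gen_coeff l c g j f = (\<Sum>q\<le>l. \<Sum>r\<le>j. of_nat (bessel_theta l q)
       * fps_nth (fps_exp (-1) * (Abs_fps c oo fps_X ^ 2)) r
       * (pochhammer (g + of_nat (q + r)) (j - r) / fact (j - r)) * f (q + r))"

lemma fps_nth_compose_square: "fps_nth (f oo fps_X ^ 2) n = (if even n then fps_nth f (n div 2) else 0)"
proof -
  have "fps_nth (f oo fps_X ^ 2) n = (\<Sum>i\<in>{0..n}. if n = 2 * i then fps_nth f i else 0)"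
    unfolding fps_compose_nth by (intro sum.cong refl) (simp add: fps_X_power_nth flip: power_mult)
  also have "\<dots> = (\<Sum>i\<in>(if even n then {n div 2} else {}). fps_nth f i)"
    by (subst sum.inter_filter[symmetric], simp, intro sum.cong) (auto elim!: evenE)
  finally show ?thesis by simp
qed

text \<open>Analytically, exp(-Y) exp(-tY/(1-t)) = exp(-Y/(1-t)), and rescaling \<open>Y\<close> by
  \<open>1 - t\<close> produces the factor (1-t)^(w-g). The proof carries out this rescaling on
  coefficients: for a fixed power \<open>m\<close> of the Bessel series, the terms of the
  exponential series sum up to the binomial coefficient
  \<open>pochhammer (g - w) (j - m) / fact (j - m)\<close>.\<close>

lemma gen_coeff_pochhammer:
  fixes w g :: "'a::field_char_0"
  shows "gen_coeff l c g j (pochhammer w) = fps_nth (negbinom_fps (g - w) *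
     Abs_fps (\<lambda>m. fps_nth (Abs_fps c oo fps_X ^ 2) m * pochhammer w m * (2 ^ l * pochhammer ((w + of_nat m + 1) / 2) l))) j"
proof -
  define e where "e = fps_nth (Abs_fps c oo fps_X ^ 2)"
  define P where "P = (\<lambda>q r i. pochhammer (g + of_nat (q + r)) i / fact i)"
  \<comment> \<open>Here \<open>r\<close> is the degree of a term of the exponential times the
    Bessel series, \<open>m\<close> is the share of the Bessel series and \<open>i = r - m\<close>
    that of the exponential.\<close>
  have triangle: "(\<Sum>r\<le>j. \<Sum>m\<le>r. F m (r - m)) = (\<Sum>m\<le>j. \<Sum>i\<le>j - m. F m i)" for F :: "nat \<Rightarrow> nat \<Rightarrow> 'a"
    by (simp add: sum.Sigma)
       (rule sum.reindex_bij_witness[of _ "\<lambda>(m, i). (m + i, m)" "\<lambda>(r, m). (m, r - m)"]; auto)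
  have inner: "(\<Sum>r\<le>j. fps_nth (fps_exp (-1) * (Abs_fps c oo fps_X ^ 2)) r * P q r (j - r) * pochhammer w (q + r))
      = (\<Sum>m\<le>j. e m * (pochhammer (g - w) (j - m) / fact (j - m)) * pochhammer w (m + q))" for q
  proof -
    have "(\<Sum>r\<le>j. fps_nth (fps_exp (-1) * (Abs_fps c oo fps_X ^ 2)) r * P q r (j - r) * pochhammer w (q + r))
       = (\<Sum>r\<le>j. \<Sum>m\<le>r. e m * ((-1) ^ (r - m) / fact (r - m)) * P q (m + (r - m)) (j - (m + (r - m))) * pochhammer w (q + (m + (r - m))))"
      by (subst mult.commute[of "fps_exp _"])
         (auto simp: fps_mult_nth e_def sum_distrib_right atLeast0AtMost intro!: sum.cong)
    also have "\<dots> = (\<Sum>m\<le>j. \<Sum>i\<le>j - m. e m * ((-1) ^ i / fact i) * P q (m + i) (j - (m + i)) * pochhammer w (q + (m + i)))"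
      by (rule triangle)
    also have "\<dots> = (\<Sum>m\<le>j. e m * (pochhammer (g - w) (j - m) / fact (j - m)) * pochhammer w (m + q))"
    proof (intro sum.cong refl)
      fix m assume "m \<in> {..j}"
      have "(\<Sum>i\<le>j - m. e m * ((-1) ^ i / fact i) * P q (m + i) (j - (m + i)) * pochhammer w (q + (m + i)))
        = e m * pochhammer w (m + q) * (\<Sum>i\<le>j - m. (-1) ^ i / fact i * pochhammer (w + of_nat (m + q)) i
             * (pochhammer (g + of_nat (m + q) + of_nat i) (j - m - i) / fact (j - m - i)))"
        unfolding sum_distrib_left
      proof (intro sum.cong refl)
        fix i
        have "pochhammer w (q + (m + i)) = pochhammer w (m + q) * pochhammer (w + of_nat (m + q)) i"
          using pochhammer_product'[of w "m + q" i] by (simp add: ac_simps)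
        moreover have "P q (m + i) (j - (m + i)) = pochhammer (g + of_nat (m + q) + of_nat i) (j - m - i) / fact (j - m - i)"
          by (simp add: P_def ac_simps)
        ultimately show "e m * ((-1) ^ i / fact i) * P q (m + i) (j - (m + i)) * pochhammer w (q + (m + i))
          = e m * pochhammer w (m + q) * ((-1) ^ i / fact i * pochhammer (w + of_nat (m + q)) i
             * (pochhammer (g + of_nat (m + q) + of_nat i) (j - m - i) / fact (j - m - i)))"
          by (simp add: mult_ac)
      qed
      also have "\<dots> = e m * pochhammer w (m + q) * (pochhammer (g - w) (j - m) / fact (j - m))"
        by (subst pochhammer_vandermonde_alternating) simp
      finally show "(\<Sum>i\<le>j - m. e m * ((-1) ^ i / fact i) * P q (m + i) (j - (m + i)) * pochhammer w (q + (m + i)))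
        = e m * (pochhammer (g - w) (j - m) / fact (j - m)) * pochhammer w (m + q)" by (simp add: mult_ac)
    qed
    finally show ?thesis .
  qed
  have "gen_coeff l c g j (pochhammer w) = (\<Sum>q\<le>l. of_nat (bessel_theta l q) *
      (\<Sum>r\<le>j. fps_nth (fps_exp (-1) * (Abs_fps c oo fps_X ^ 2)) r * P q r (j - r) * pochhammer w (q + r)))"
    unfolding gen_coeff_def P_def sum_distrib_left by (simp add: mult_ac)
  also have "\<dots> = (\<Sum>m\<le>j. \<Sum>q\<le>l. of_nat (bessel_theta l q) * (e m * (pochhammer (g - w) (j - m) / fact (j - m)) * pochhammer w (m + q)))"
    unfolding inner sum_distrib_left by (rule sum.swap)
  also have "\<dots> = (\<Sum>m\<le>j. e m * pochhammer w m * (pochhammer (g - w) (j - m) / fact (j - m))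
       * (\<Sum>q\<le>l. of_nat (bessel_theta l q) * pochhammer (w + of_nat m) q))"
    unfolding sum_distrib_left by (intro sum.cong refl) (simp add: pochhammer_product' mult_ac)
  also have "\<dots> = (\<Sum>m\<le>j. (e m * pochhammer w m * (2 ^ l * pochhammer ((w + of_nat m + 1) / 2) l))
       * (pochhammer (g - w) (j - m) / fact (j - m)))"
    unfolding sum_bessel_theta_pochhammer by (simp add: mult_ac)
  finally show ?thesis
    by (subst mult.commute) (simp add: fps_mult_nth e_def atLeast0AtMost)
qed

text \<open>Only even degrees 2n survive. There the duplication (w)_(2n) = 4^n (w/2)_n ((w+1)/2)_n
  cancels the \<open>4 ^ n\<close> of the Bessel coefficients, and splitting ((w+1)/2)_(n+l) in the
  other order leaves a factor free of \<open>n\<close> and shifts the second parameter by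
  \<open>l\<close>.\<close>

lemma gen_coeff_pochhammer_hyp:
  fixes w m c0 :: "'a::field_char_0"
  assumes c: "\<And>n. c n = c0 / (4 ^ n * fact n * pochhammer (m + 1) n)"
  shows "gen_coeff l c g j (pochhammer w) = 2 ^ l * pochhammer ((w + 1) / 2) l * c0 *
     fps_nth (negbinom_fps (g - w) * (gauss_hyp_fps (w / 2) ((w + 1) / 2 + of_nat l) (m + 1) oo fps_X ^ 2)) j"
proof -
  define K where "K = 2 ^ l * pochhammer ((w + 1) / 2) l * c0"
  have "Abs_fps (\<lambda>n. fps_nth (Abs_fps c oo fps_X ^ 2) n * pochhammer w n * (2 ^ l * pochhammer ((w + of_nat n + 1) / 2) l))
     = fps_const K * (gauss_hyp_fps (w / 2) ((w + 1) / 2 + of_nat l) (m + 1) oo fps_X ^ 2)"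
  proof (rule fps_ext)
    fix k
    show "fps_nth (Abs_fps (\<lambda>n. fps_nth (Abs_fps c oo fps_X ^ 2) n * pochhammer w n * (2 ^ l * pochhammer ((w + of_nat n + 1) / 2) l))) k
     = fps_nth (fps_const K * (gauss_hyp_fps (w / 2) ((w + 1) / 2 + of_nat l) (m + 1) oo fps_X ^ 2)) k"
    proof (cases "even k")
      case True
      then obtain n where k: "k = 2 * n" by (rule evenE)
      have 1: "pochhammer w (2 * n) = 4 ^ n * pochhammer (w / 2) n * pochhammer ((w + 1) / 2) n"
        using pochhammer_double[of "w / 2" n] by (simp add: power_mult add_divide_distrib)
      have 2: "pochhammer ((w + 1) / 2) n * pochhammer ((w + of_nat k + 1) / 2) l
          = pochhammer ((w + 1) / 2) l * pochhammer ((w + 1) / 2 + of_nat l) n"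
      proof -
        have *: "(w + of_nat k + 1) / 2 = (w + 1) / 2 + of_nat n" by (simp add: k field_simps)
        show ?thesis
          unfolding *
          using pochhammer_product'[of "(w + 1) / 2" n l] pochhammer_product'[of "(w + 1) / 2" l n]
          by (simp add: add.commute)
      qed
      have "fps_nth (Abs_fps (\<lambda>n. fps_nth (Abs_fps c oo fps_X ^ 2) n * pochhammer w n * (2 ^ l * pochhammer ((w + of_nat n + 1) / 2) l))) k
         = c n * (4 ^ n * pochhammer (w / 2) n) * 2 ^ l * (pochhammer ((w + 1) / 2) n * pochhammer ((w + of_nat k + 1) / 2) l)"
        by (simp add: fps_nth_compose_square k 1[unfolded mult.commute[of 2 n]] mult_ac)
      also have "\<dots> = fps_nth (fps_const K * (gauss_hyp_fps (w / 2) ((w + 1) / 2 + of_nat l) (m + 1) oo fps_X ^ 2)) k"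
        unfolding 2 by (simp add: fps_nth_compose_square k c K_def)
      finally show ?thesis .
    qed (simp add: fps_nth_compose_square)
  qed
  then have "gen_coeff l c g j (pochhammer w) = fps_nth (negbinom_fps (g - w) *
       (fps_const K * (gauss_hyp_fps (w / 2) ((w + 1) / 2 + of_nat l) (m + 1) oo fps_X ^ 2))) j"
    unfolding gen_coeff_pochhammer by simp
  also have "\<dots> = K * fps_nth (negbinom_fps (g - w) *
       (gauss_hyp_fps (w / 2) ((w + 1) / 2 + of_nat l) (m + 1) oo fps_X ^ 2)) j"
    by (simp add: mult.left_commute[of _ "fps_const K"])
  finally show ?thesis unfolding K_def .
qed

text \<open>The condition on \<open>g\<close> makes the exponent in Euler's transformation equal to
  \<open>w - g\<close>. In the variable t^2 its factor is (1-t)^(g-w) (1+t)^(g-w). The first part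
  cancels the prefactor (1-t)^(w-g); the second, because g-w = w'-g, is the prefactor for
  \<open>w'\<close> taken at -t. The hypergeometric factor is even in t.\<close>

theorem gen_coeff_functional_equation:
  fixes w w' m c0 :: "'a::field_char_0"
  assumes c: "\<And>n. c n = c0 / (4 ^ n * fact n * pochhammer (m + 1) n)"
    and m: "\<And>n. m + 1 + of_nat n \<noteq> 0"
    and g: "g = m + 1 / 2 - of_nat l" and w: "w + w' = 2 * g"
  shows "pochhammer ((w' + 1) / 2) l * gen_coeff l c g j (pochhammer w)
       = (-1) ^ j * (pochhammer ((w + 1) / 2) l * gen_coeff l c g j (pochhammer w'))"
proof -
  define Q where "Q = (\<lambda>w. negbinom_fps (g - w) * (gauss_hyp_fps (w / 2) ((w + 1) / 2 + of_nat l) (m + 1) oo fps_X ^ 2))"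
  have w': "w' = 2 * m + 1 - 2 * of_nat l - w"
  proof -
    have "w' = 2 * g - w" using w by (simp add: eq_diff_eq add.commute)
    then show ?thesis by (simp add: g algebra_simps)
  qed
  define H where "H = gauss_hyp_fps (w' / 2) ((w' + 1) / 2 + of_nat l) (m + 1)"
  have H: "gauss_hyp_fps (w / 2) ((w + 1) / 2 + of_nat l) (m + 1) = negbinom_fps (w - g) * H"
  proof -
    have "gauss_hyp_fps (w / 2) ((w + 1) / 2 + of_nat l) (m + 1) = negbinom_fps (w / 2 + ((w + 1) / 2 + of_nat l) - (m + 1))
       * gauss_hyp_fps (m + 1 - w / 2) (m + 1 - ((w + 1) / 2 + of_nat l)) (m + 1)"
      by (rule euler_transformation_fps) (rule m)
    also have "w / 2 + ((w + 1) / 2 + of_nat l) - (m + 1) = w - g"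
      by (simp add: g field_simps)
    also have "m + 1 - w / 2 = (w' + 1) / 2 + of_nat l"
      by (simp add: w' field_simps)
    also have "m + 1 - ((w + 1) / 2 + of_nat l) = w' / 2"
      by (simp add: w' field_simps)
    also have "gauss_hyp_fps ((w' + 1) / 2 + of_nat l) (w' / 2) (m + 1) = H"
      unfolding H_def by (rule fps_ext) (simp add: mult.commute)
    finally show ?thesis .
  qed
  have even: "H oo fps_X ^ 2 = (H oo fps_X ^ 2) oo (fps_const (-1) * fps_X)"
    unfolding fps_compose_linear by (rule fps_ext) (simp add: fps_nth_compose_square)
  have "Q w = negbinom_fps (g - w) * negbinom_fps (w - g) * ((negbinom_fps (w - g) oo (fps_const (-1) * fps_X)) * (H oo fps_X ^ 2))"
    unfolding Q_def H by (simp add: fps_compose_mult_distrib negbinom_fps_compose_square mult.assoc)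
  also have "negbinom_fps (g - w) * negbinom_fps (w - g) = 1"
    by (simp flip: negbinom_fps_add)
  also have "w - g = g - w'" using w by (simp add: algebra_simps)
  also have "1 * ((negbinom_fps (g - w') oo (fps_const (-1) * fps_X)) * (H oo fps_X ^ 2)) = Q w' oo (fps_const (-1) * fps_X)"
    by (subst even) (simp add: Q_def H_def fps_compose_mult_distrib)
  finally have "fps_nth (Q w) j = (-1) ^ j * fps_nth (Q w') j"
    unfolding fps_compose_linear by simp
  then show ?thesis
    unfolding gen_coeff_pochhammer_hyp[OF c] Q_def by (simp add: mult_ac)
qed

section \<open>Macdonald functions of half-integer order\<close>

lemma set_integral_atLeast_eq_greaterThan:
  fixes f :: "real \<Rightarrow> 'a::{banach, second_countable_topology}"
  assumes "f \<in> borel_measurable borel"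
  shows "(LINT t:{a..}|lborel. f t) = (LINT t:{a<..}|lborel. f t)"
proof (rule set_integral_cong_set)
  show "AE x in lborel. (x \<in> {a<..}) = (x \<in> {a..})"
    using AE_lborel_singleton[of a] by eventually_elim auto
qed (use assms in \<open>auto simp: set_borel_measurable_def\<close>)

lemma set_integrable_exp_minus: "set_integrable lborel {0..} (\<lambda>t::real. exp (-t))"
  unfolding set_integrable_def
proof (rule integrableI_bounded)
  have "(\<integral>\<^sup>+ x. ennreal (norm (indicator {0::real..} x *\<^sub>R exp (- x))) \<partial>lborel)
      = (\<integral>\<^sup>+ x. ennreal (x ^ 0 * exp (-x)) * indicator {0..} x \<partial>lborel)"
    by (intro nn_integral_cong) (simp split: split_indicator)
  also have "\<dots> < \<infinity>" by (subst nn_intergal_power_times_exp_Ici) simp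
  finally show "(\<integral>\<^sup>+ x. ennreal (norm (indicator {0::real..} x *\<^sub>R exp (- x))) \<partial>lborel) < \<infinity>" .
qed simp

text \<open>The exponent is the maximum over \<open>t\<close> of
  \<open>(|a| + 1) * t - z * t^2 / 4\<close>. Since \<open>cosh t\<close> is at least
  \<open>t^2 / 4\<close> for nonnegative \<open>t\<close>, this controls the integrand, and the
  \<open>+ 1\<close> leaves a factor \<open>exp (-t)\<close> for integrability.\<close>

definition besselK_bound :: "real \<Rightarrow> real \<Rightarrow> real" where
  "besselK_bound a z = exp ((\<bar>a\<bar> + 1)\<^sup>2 / z)"

lemma besselK_integrand_le:
  assumes "z > 0" "t \<ge> 0"
  shows "exp (- z * cosh t) * cosh (a * t) \<le> besselK_bound a z * exp (-t)"
proof -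
  define b where "b = \<bar>a\<bar> + 1"
  have "t\<^sup>2 / 4 \<le> exp t / 2"
    using exp_lower_Taylor_quadratic[OF assms(2)] assms(2) by simp
  also have "\<dots> \<le> cosh t" by (simp add: cosh_def)
  finally have "z * (t\<^sup>2 / 4) \<le> z * cosh t" using assms by simp
  moreover have "b * t \<le> z * (t\<^sup>2 / 4) + b\<^sup>2 / z"
  proof -
    have "0 \<le> (z * t / 2 - b)\<^sup>2 / z" using assms by simp
    also have "\<dots> = z * (t\<^sup>2 / 4) + b\<^sup>2 / z - b * t"
      using assms by (simp add: field_simps power2_eq_square)
    finally show ?thesis by simp
  qed
  ultimately have *: "- z * cosh t + \<bar>a\<bar> * t \<le> b\<^sup>2 / z + - t"
    by (simp add: b_def algebra_simps)
  have "cosh (a * t) = cosh (\<bar>a\<bar> * t)" by (cases "a \<ge> 0") simp_all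
  also have "\<dots> \<le> exp (\<bar>a\<bar> * t)"
    using assms by (simp flip: cosh_plus_sinh)
  finally have "exp (- z * cosh t) * cosh (a * t) \<le> exp (- z * cosh t) * exp (\<bar>a\<bar> * t)"
    by simp
  also have "\<dots> \<le> exp (b\<^sup>2 / z) * exp (-t)"
    using * by (simp flip: exp_add)
  finally show ?thesis by (simp add: besselK_bound_def b_def)
qed

lemma besselK_integrable:
  fixes a z :: real
  assumes "z > 0"
  shows "set_integrable lborel {0..} (\<lambda>t. exp (- z * cosh t) * cosh (a * t))"
proof (rule set_integrable_bound)
  show "set_integrable lborel {0..} (\<lambda>t. besselK_bound a z * exp (-t))"
    by (intro set_integrable_mult_right impI set_integrable_exp_minus)
  show "set_borel_measurable lborel {0..} (\<lambda>t. exp (- z * cosh t) * cosh (a * t))"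
    unfolding set_borel_measurable_def
    by (intro borel_measurable_scaleR borel_measurable_continuous_onI) (auto intro!: continuous_intros borel_measurable_continuous_onI)
  show "AE x in lborel. x \<in> {0..} \<longrightarrow> norm (exp (- z * cosh x) * cosh (a * x)) \<le> norm (besselK_bound a z * exp (- x))"
    using besselK_integrand_le[OF assms] by (auto simp: besselK_bound_def)
qed

lemma besselK_altdef: "besselK a z = (LINT t:{0<..}|lborel. exp (- z * cosh t) * cosh (a * t))"
  unfolding besselK_def
  by (rule set_integral_atLeast_eq_greaterThan) (intro borel_measurable_continuous_onI continuous_intros)

lemma besselK_integrable':
  fixes a z :: real
  assumes "z > 0"
  shows "set_integrable lborel {0<..} (\<lambda>t. exp (- z * cosh t) * cosh (a * t))"
  by (rule set_integrable_subset[OF besselK_integrable[OF assms]]) (auto intro: less_imp_le)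

text \<open>The derivative of \<open>exp (- z * cosh t) * sinh (a * t)\<close> is integrated over
  the half-line. The function vanishes at 0 and at infinity, and the product of hyperbolic sines in
  its derivative splits into hyperbolic cosines of \<open>(a + 1) * t\<close> and
  \<open>(a - 1) * t\<close>.\<close>

lemma besselK_recurrence:
  assumes "z > 0"
  shows "besselK (a + 1) z = besselK (a - 1) z + 2 * a / z * besselK a z"
proof -
  define k where "k = (\<lambda>b t. exp (- z * cosh t) * cosh (b * t))"
  define F where "F = (\<lambda>t. exp (- z * cosh t) * sinh (a * t))"
  define f where "f = (\<lambda>t. a * k a t - z / 2 * (k (a + 1) t - k (a - 1) t))"
  have k: "set_integrable lborel {0<..} (k b)" for b
    unfolding k_def by (rule besselK_integrable'[OF assms])
  have "(LBINT t=ereal 0..\<infinity>. f t) = 0 - 0"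
  proof (rule interval_integral_FTC_integrable[where F = F])
    fix x :: real
    have "f x = - z * sinh x * exp (- z * cosh x) * sinh (a * x) + exp (- z * cosh x) * (a * cosh (a * x))"
      unfolding f_def k_def by (simp add: cosh_add cosh_diff algebra_simps)
    moreover have "(F has_real_derivative - z * sinh x * exp (- z * cosh x) * sinh (a * x)
        + exp (- z * cosh x) * (a * cosh (a * x))) (at x)"
      unfolding F_def by (auto intro!: derivative_eq_intros)
    ultimately show "(F has_vector_derivative f x) (at x)"
      by (simp add: has_real_derivative_iff_has_vector_derivative)
    show "isCont f x" unfolding f_def k_def by (intro continuous_intros)
  next
    show "set_integrable lborel (einterval (ereal 0) \<infinity>) f"
      unfolding f_def using k by (auto intro!: set_integral_diff)
    show "((F \<circ> real_of_ereal) \<longlongrightarrow> 0) (at_right (ereal 0))"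
      unfolding F_def ereal_tendsto_simps by (auto intro!: tendsto_eq_intros)
    have "(F \<longlongrightarrow> 0) at_top"
    proof (rule tendsto_0_le)
      show "((\<lambda>t::real. exp (-t)) \<longlongrightarrow> 0) at_top"
        by (intro filterlim_compose[OF exp_at_bot] filterlim_uminus_at_bot_at_top)
      show "\<forall>\<^sub>F t in at_top. norm (F t) \<le> norm (exp (-t)) * besselK_bound a z"
        using eventually_ge_at_top[of 0]
      proof eventually_elim
        case (elim t)
        have "\<bar>sinh (a * t)\<bar> \<le> cosh (a * t)"
          using sinh_less_cosh_real[of "a * t"] sinh_less_cosh_real[of "- (a * t)"] by simp
        then have "norm (F t) \<le> exp (- z * cosh t) * cosh (a * t)"
          by (simp add: F_def abs_mult)
        also note besselK_integrand_le[OF assms elim]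
        finally show ?case by (simp add: mult.commute)
      qed
    qed
    then show "((F \<circ> real_of_ereal) \<longlongrightarrow> 0) (at_left \<infinity>)"
      unfolding ereal_tendsto_simps .
  qed simp
  also have "(LBINT t=ereal 0..\<infinity>. f t) = a * besselK a z - z / 2 * (besselK (a + 1) z - besselK (a - 1) z)"
  proof -
    have "besselK b z = (LINT t:{0<..}|lborel. k b t)" for b
      unfolding k_def by (rule besselK_altdef)
    then show ?thesis
      unfolding interval_integral_to_infinity_eq f_def
      using k by (subst set_integral_diff) (auto intro!: set_integral_diff)
  qed
  finally show ?thesis using assms by (simp add: field_simps)
qed

lemma besselK_minus: "besselK (- a) z = besselK a z"
  by (simp add: besselK_def)

text \<open>Since cosh t = 1 + 2 sinh^2(t/2), the substitution
  \<open>sqrt (2 * z) * sinh (t / 2)\<close> turns the integral into half of a Gaussian integral;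
  the factor \<open>cosh (t / 2)\<close> is its derivative up to a constant.\<close>

lemma besselK_half:
  assumes z: "z > 0"
  shows "besselK (1 / 2) z = sqrt (pi / (2 * z)) * exp (- z)"
proof -
  define g where "g = (\<lambda>t::real. sqrt (2 * z) * sinh (t / 2))"
  define g' where "g' = (\<lambda>t::real. sqrt (2 * z) * (cosh (t / 2) / 2))"
  have eq: "g' t *\<^sub>R exp (- (g t)\<^sup>2) = sqrt (2 * z) / 2 * exp z * (exp (- z * cosh t) * cosh (1 / 2 * t))" for t
  proof -
    have "cosh t = 2 * sinh (t / 2) ^ 2 + 1"
      using cosh_double[of "t / 2"] by (simp add: cosh_square_eq)
    then have "- (g t)\<^sup>2 = z + - z * cosh t"
      using z by (simp add: g_def power_mult_distrib algebra_simps)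
    then have "exp (- (g t)\<^sup>2) = exp z * exp (- z * cosh t)"
      by (simp only: exp_add)
    then show ?thesis by (simp add: g'_def)
  qed
  have gauss: "set_integrable lborel {0..} (\<lambda>x::real. exp (- x\<^sup>2))" "(LINT x:{0..}|lborel. exp (- x\<^sup>2)) = sqrt pi / 2"
    using gaussian_moment_0 unfolding set_integrable_def set_lebesgue_integral_def has_bochner_integral_iff by auto
  have "sqrt pi / 2 = (LBINT x=ereal 0..\<infinity>. exp (- x\<^sup>2))"
    unfolding gauss(2)[symmetric] interval_integral_to_infinity_eq
    by (rule set_integral_atLeast_eq_greaterThan) (intro borel_measurable_continuous_onI continuous_intros)
  also have "\<dots> = (LBINT t=ereal 0..\<infinity>. g' t *\<^sub>R exp (- (g t)\<^sup>2))"
  proof (rule interval_integral_substitution_integrable)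
    show "((ereal \<circ> g \<circ> real_of_ereal) \<longlongrightarrow> ereal 0) (at_right (ereal 0))"
      unfolding ereal_tendsto_simps g_def by (auto intro!: tendsto_eq_intros)
    show "((ereal \<circ> g \<circ> real_of_ereal) \<longlongrightarrow> \<infinity>) (at_left \<infinity>)"
      unfolding ereal_tendsto_simps g_def using z
      by (intro filterlim_tendsto_pos_mult_at_top[OF tendsto_const] filterlim_compose[OF sinh_real_at_top])
         (auto intro!: filterlim_tendsto_pos_mult_at_top[OF tendsto_const, where c = "1/2", simplified] filterlim_ident)
    show "set_integrable lborel (einterval (ereal 0) \<infinity>) (\<lambda>x. g' x *\<^sub>R exp (- (g x)\<^sup>2))"
      unfolding eq einterval_eq by (intro set_integrable_mult_right impI besselK_integrable' z)
    show "set_integrable lborel (einterval (ereal 0) \<infinity>) (\<lambda>x. exp (- x\<^sup>2))"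
      unfolding einterval_eq by (rule set_integrable_subset[OF gauss(1)]) auto
  qed (use z in \<open>auto simp: g_def g'_def intro!: derivative_eq_intros continuous_intros\<close>)
  also have "\<dots> = sqrt (2 * z) / 2 * exp z * besselK (1 / 2) z"
    unfolding eq interval_integral_to_infinity_eq besselK_altdef by simp
  finally have "besselK (1 / 2) z = sqrt pi / (sqrt (2 * z) * exp z)"
    using z by (simp add: field_simps)
  then show ?thesis by (simp add: real_sqrt_divide exp_minus field_simps)
qed

theorem besselK_half_integer:
  assumes z: "z > 0"
  shows "besselK (real l + 1 / 2) z =
    sqrt (pi / (2 * z)) * exp (- z) * (\<Sum>q\<le>l. real (bessel_theta l q) * z ^ q) / z ^ l"
proof (induction l rule: induct_nat_012)
  case 0
  show ?case using besselK_half[OF z] by simp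
next
  case 1
  \<comment> \<open>For order 3/2 the recurrence reaches down to order -1/2, which evenness in the
    order identifies with 1/2.\<close>
  show ?case
    using besselK_recurrence[OF z, of "1 / 2"] besselK_half[OF z] besselK_minus[of "1 / 2" z] z
    by (simp add: field_simps)
next
  case (ge2 l)
  have 1: "besselK (real (Suc (Suc l)) + 1 / 2) z = besselK (real l + 1 / 2) z
      + (2 * real l + 3) / z * besselK (real (Suc l) + 1 / 2) z"
    using besselK_recurrence[OF z, of "real (Suc l) + 1 / 2"] by (simp add: algebra_simps)
  have 2: "(\<Sum>q\<le>l. real (bessel_theta l q) * z ^ (q + 2)) = z\<^sup>2 * (\<Sum>q\<le>l. real (bessel_theta l q) * z ^ q)"
    unfolding sum_distrib_left power_add by (simp only: mult_ac)
  show ?case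
    unfolding 1 sum_bessel_theta_Suc_Suc 2 ge2.IH using z
    by (simp add: field_simps power2_eq_square del: sum.atMost_Suc)
qed

lemma besselK_tilde_half_integer:
  assumes z: "z > 0"
  shows "besselK_tilde (real l + 1 / 2) z =
    sqrt pi * 2 ^ l * exp (- z) * (\<Sum>q\<le>l. real (bessel_theta l q) * z ^ q) / z ^ (2 * l + 1)"
proof -
  \<comment> \<open>The normalising power and the square root in the closed form contribute one
    factor \<open>1 / s\<close> each, so only integral powers of \<open>z\<close> remain.\<close>
  define s where "s = sqrt (z / 2)"
  have s: "s > 0" "s * s = z / 2" using z by (simp_all add: s_def)
  have "sqrt (2 * z) = sqrt (4 * (z / 2))" by simp
  also have "\<dots> = 2 * s" unfolding real_sqrt_mult s_def by simp
  finally have 1: "sqrt (pi / (2 * z)) = sqrt pi / (2 * s)" by (simp only: real_sqrt_divide)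
  have "(z / 2) powr (real l + 1 / 2) = (z / 2) ^ l * s"
    using z by (simp add: powr_add powr_realpow powr_half_sqrt s_def)
  then have 2: "(z / 2) powr (- (real l + 1 / 2)) = 1 / ((z / 2) ^ l * s)"
    by (simp only: powr_minus divide_inverse mult_1)
  have "(z / 2) powr (- (real l + 1 / 2)) * sqrt (pi / (2 * z)) = sqrt pi / ((z / 2) ^ l * (2 * (s * s)))"
    unfolding 1 2 by simp
  also have "\<dots> = sqrt pi * 2 ^ l / z ^ (l + 1)"
    unfolding s(2) using z by (simp add: power_divide)
  finally have *: "(z / 2) powr (- (real l + 1 / 2)) * sqrt (pi / (2 * z)) = sqrt pi * 2 ^ l / z ^ (l + 1)" .
  have "besselK_tilde (real l + 1 / 2) z = ((z / 2) powr (- (real l + 1 / 2)) * sqrt (pi / (2 * z)))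
     * (exp (- z) * (\<Sum>q\<le>l. real (bessel_theta l q) * z ^ q) / z ^ l)"
    unfolding besselK_tilde_def besselK_half_integer[OF z] by (simp only: times_divide_eq_right mult.assoc)
  also have "\<dots> = sqrt pi * 2 ^ l * exp (- z) * (\<Sum>q\<le>l. real (bessel_theta l q) * z ^ q) / (z ^ (l + 1) * z ^ l)"
    unfolding * by simp
  also have "z ^ (l + 1) * z ^ l = z ^ (2 * l + 1)"
    by (simp flip: power_add add: mult_2)
  finally show ?thesis .
qed

section \<open>Expansion of the generating function\<close>

lemma higher_deriv_0_eq_fps_nth:
  fixes f :: "real \<Rightarrow> real"
  assumes "f has_fps_expansion F"
  shows "(deriv ^^ n) f 0 = fact n * fps_nth F n"
  using assms
proof (induction n arbitrary: f F)
  case 0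
  then have "f 0 = eval_fps F 0"
    unfolding has_fps_expansion_def using eventually_nhds_x_imp_x by force
  then show ?case by (simp add: eval_fps_at_0)
next
  case (Suc n)
  have "(deriv ^^ Suc n) f 0 = (deriv ^^ n) (deriv f) 0"
    by (simp only: funpow_Suc_right o_apply)
  also have "\<dots> = fact n * fps_nth (fps_deriv F) n"
    by (intro Suc.IH has_fps_expansion_deriv Suc.prems)
  finally show ?case by (simp add: mult_ac)
qed

text \<open>The expansions of binomial powers and of compositions are formed over the complex
  numbers, whereas \<open>Mpoly\<close> takes real derivatives; real coefficients and agreement near
  0 bridge the two.\<close>

lemma has_fps_expansion_of_real_transfer:
  fixes f :: "real \<Rightarrow> real" and g :: "complex \<Rightarrow> complex"
  assumes g: "g has_fps_expansion G"
    and coeff: "\<And>n. fps_nth G n = of_real (fps_nth F n)"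
    and eq: "\<forall>\<^sub>F t in nhds 0. g (of_real t) = of_real (f t)"
  shows "f has_fps_expansion F"
proof (rule has_fps_expansionI)
  have rad: "fps_conv_radius G > 0" and ev: "\<forall>\<^sub>F z in nhds 0. eval_fps G z = g z"
    using g by (auto simp: has_fps_expansion_def)
  have "\<forall>\<^sub>F z in nhds 0. z \<in> eball 0 (fps_conv_radius G)"
    using rad by (intro eventually_nhds_in_open) (auto simp: zero_ereal_def)
  with ev have "\<forall>\<^sub>F z in nhds 0. (\<lambda>n. fps_nth G n * z ^ n) sums g z"
  proof eventually_elim
    case (elim z)
    then show ?case using sums_eval_fps[of z G] by (simp add: zero_ereal_def)
  qed
  moreover have "filterlim complex_of_real (nhds 0) (nhds 0)"
    using tendsto_of_real[OF filterlim_ident, of 0] by simp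
  ultimately have "\<forall>\<^sub>F t in nhds (0::real). (\<lambda>n. fps_nth G n * of_real t ^ n) sums g (of_real t)"
    by (rule eventually_compose_filterlim)
  with eq show "\<forall>\<^sub>F t in nhds 0. (\<lambda>n. fps_nth F n * t ^ n) sums f t"
  proof eventually_elim
    case (elim t)
    then have "(\<lambda>n. complex_of_real (fps_nth F n * t ^ n)) sums of_real (f t)"
      by (simp add: coeff)
    then show ?case by (simp only: sums_of_real_iff)
  qed
qed

lemma has_fps_expansion_negbinom: "(\<lambda>t. (1 - t) powr (- b)) has_fps_expansion (negbinom_fps b :: complex fps)"
proof (rule has_fps_expansionI)
  have "\<forall>\<^sub>F t::complex in nhds 0. t \<in> ball 0 1"
    by (intro eventually_nhds_in_open) auto
  then show "\<forall>\<^sub>F t in nhds 0. (\<lambda>n. fps_nth (negbinom_fps b) n * t ^ n) sums (1 - t) powr (- b)"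
  proof eventually_elim
    case (elim t)
    have "(\<lambda>n. (- b gchoose n) * (- t) ^ n) sums (1 + - t) powr (- b)"
      using elim by (intro gen_binomial_complex) simp
    also have "(\<lambda>n. (- b gchoose n) * (- t) ^ n) = (\<lambda>n. fps_nth (negbinom_fps b) n * t ^ n)"
    proof
      fix n
      have "(-1) ^ n * (-1) ^ n = (1::complex)" by (simp flip: power_mult_distrib)
      then show "(- b gchoose n) * (- t) ^ n = fps_nth (negbinom_fps b) n * t ^ n"
        by (simp add: gbinomial_pochhammer power_minus[of t] mult_ac)
    qed
    finally show ?case by simp
  qed
qed

text \<open>As \<open>U\<close> has no constant term, \<open>U ^ i\<close> reaches coefficient
  \<open>j\<close> only for \<open>i \<le> j\<close>. The coefficient becomes a finite sum in which
  \<open>A\<close> can be merged with each power of \<open>U\<close> separately.\<close>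

lemma fps_nth_mult_compose:
  fixes A H U :: "'a::comm_ring_1 fps"
  assumes "fps_nth U 0 = 0"
  shows "fps_nth (A * (H oo U)) j = (\<Sum>i\<le>j. fps_nth H i * fps_nth (A * U ^ i) j)"
proof -
  have zero: "fps_nth (U ^ i) k = 0" if "k < i" for i k
    using startsby_zero_power_prefix[OF assms] that by blast
  have "fps_nth (A * (H oo U)) j = (\<Sum>k\<le>j. \<Sum>i\<le>j. fps_nth A k * (fps_nth H i * fps_nth (U ^ i) (j - k)))"
    unfolding fps_mult_nth fps_compose_nth atLeast0AtMost sum_distrib_left
    by (intro sum.cong[OF refl] sum.mono_neutral_left) (auto simp: zero)
  also have "\<dots> = (\<Sum>i\<le>j. \<Sum>k\<le>j. fps_nth A k * (fps_nth H i * fps_nth (U ^ i) (j - k)))"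
    by (rule sum.swap)
  finally show ?thesis
    by (simp add: fps_mult_nth atLeast0AtMost sum_distrib_left mult_ac)
qed

text \<open>Coefficient of z^(2n) in \<open>besselI_tilde a z\<close>. The reciprocal Gamma factor
  is split off \<open>rGamma (a + 1)\<close> by a Pochhammer symbol, to fit the hypothesis of
  \<open>gen_coeff_pochhammer_hyp\<close>.\<close>

definition besselI_coeff :: "real \<Rightarrow> nat \<Rightarrow> real" where
  "besselI_coeff a n = rGamma (a + 1) / (4 ^ n * fact n * pochhammer (a + 1) n)"

lemma besselI_coeff_eq:
  assumes "a \<ge> 0"
  shows "rGamma (real n + a + 1) / fact n / 4 ^ n = besselI_coeff a n"
proof -
  have "pochhammer (a + 1) n > 0" using assms by (intro pochhammer_pos) simp
  then show ?thesis
    using pochhammer_rGamma[of "a + 1" n] by (simp add: besselI_coeff_def add_ac)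
qed

lemma besselI_coeff_bound:
  assumes "a \<ge> 0"
  shows "norm (besselI_coeff a n) \<le> \<bar>rGamma (a + 1)\<bar> / fact n"
proof -
  have p: "1 \<le> pochhammer (a + 1) n"
    unfolding pochhammer_prod using assms by (intro prod_ge_1) auto
  moreover have "(1::real) \<le> 4 ^ n" by simp
  ultimately have *: "1 * 1 \<le> 4 ^ n * pochhammer (a + 1) n" by (intro mult_mono) auto
  have "norm (besselI_coeff a n) = \<bar>rGamma (a + 1)\<bar> / (fact n * (4 ^ n * pochhammer (a + 1) n))"
    unfolding besselI_coeff_def using p by (simp add: abs_mult mult_ac)
  also have "\<dots> \<le> \<bar>rGamma (a + 1)\<bar> / (fact n * (1 * 1))"
    using * p by (intro divide_left_mono mult_left_mono mult_pos_pos) auto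
  finally show ?thesis by simp
qed

lemma besselI_sums:
  assumes "a \<ge> 0"
  shows "(\<lambda>n. complex_of_real (besselI_coeff a n) * (z\<^sup>2) ^ n) sums (\<Sum>n. of_real (besselI_coeff a n) * (z\<^sup>2) ^ n)"
proof (rule summable_sums, rule summable_comparison_test')
  show "summable (\<lambda>n. \<bar>rGamma (a + 1)\<bar> * (norm z ^ 2) ^ n /\<^sub>R fact n)"
    using summable_mult[OF summable_exp_generic[of "norm z ^ 2"], of "\<bar>rGamma (a + 1)\<bar>"] by (simp add: mult_ac)
  show "norm (of_real (besselI_coeff a n) * (z\<^sup>2) ^ n) \<le> \<bar>rGamma (a + 1)\<bar> * (norm z ^ 2) ^ n /\<^sub>R fact n" if "n \<ge> 0" for n
    using mult_right_mono[OF besselI_coeff_bound[OF assms, of n], of "(norm z ^ 2) ^ n"]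
    by (simp add: norm_mult norm_power divide_inverse mult_ac)
qed

definition besselI_complex :: "real \<Rightarrow> complex \<Rightarrow> complex" where
  "besselI_complex a z = (\<Sum>n. of_real (besselI_coeff a n) * (z\<^sup>2) ^ n)"

lemma besselI_complex_of_real:
  assumes "a \<ge> 0"
  shows "besselI_complex a (of_real x) = of_real (besselI_tilde a x)"
proof -
  have "(\<lambda>n. complex_of_real (besselI_coeff a n * (x\<^sup>2) ^ n)) sums besselI_complex a (of_real x)"
    using besselI_sums[OF assms, of "of_real x"] by (simp add: besselI_complex_def)
  moreover have "besselI_coeff a n * (x\<^sup>2) ^ n = (x / 2) ^ (2 * n) * rGamma (real n + a + 1) / fact n" for n
  proof -
    have "(x / 2) ^ (2 * n) = (x\<^sup>2) ^ n / 4 ^ n"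
      unfolding power_mult by (simp add: power_divide)
    then show ?thesis unfolding besselI_coeff_eq[OF assms, symmetric] by (simp add: mult_ac)
  qed
  ultimately have *: "(\<lambda>n. complex_of_real ((x / 2) ^ (2 * n) * rGamma (real n + a + 1) / fact n)) sums besselI_complex a (of_real x)"
    by simp
  then have "summable (\<lambda>n. (x / 2) ^ (2 * n) * rGamma (real n + a + 1) / fact n)"
    by (metis sums_summable summable_of_real_iff)
  then have "(\<lambda>n. complex_of_real ((x / 2) ^ (2 * n) * rGamma (real n + a + 1) / fact n)) sums of_real (besselI_tilde a x)"
    unfolding besselI_tilde_def by (intro sums_of_real summable_sums)
  with * show ?thesis by (rule sums_unique2)
qed

lemma has_fps_expansion_besselI_complex:
  assumes "a \<ge> 0"
  shows "besselI_complex a has_fps_expansion (Abs_fps (\<lambda>n. of_real (besselI_coeff a n)) oo fps_X ^ 2)"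
proof (rule has_fps_expansionI, rule always_eventually, rule allI)
  fix z :: complex
  let ?F = "Abs_fps (\<lambda>n. complex_of_real (besselI_coeff a n)) oo fps_X ^ 2"
  have "(\<lambda>n. fps_nth ?F (2 * n) * z ^ (2 * n)) sums besselI_complex a z"
    using besselI_sums[OF assms, of z] by (simp add: fps_nth_compose_square power_mult besselI_complex_def)
  moreover have "fps_nth ?F n * z ^ n = 0" if "n \<notin> range (\<lambda>n. 2 * n)" for n
  proof -
    have "odd n" using that by (auto elim: evenE)
    then show ?thesis by (simp add: fps_nth_compose_square)
  qed
  ultimately show "(\<lambda>n. fps_nth ?F n * z ^ n) sums besselI_complex a z"
    by (subst (asm) sums_mono_reindex) (auto simp: strict_mono_def)
qed

lemma fps_nth_exp_mult_compose_of_real: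
  "fps_nth (fps_exp (-1) * (Abs_fps (\<lambda>n. of_real (c n)) oo fps_X ^ 2)) n
   = (of_real (fps_nth (fps_exp (-1) * (Abs_fps c oo fps_X ^ 2)) n) :: 'a::{real_normed_field,field_char_0})"
proof -
  have "fps_nth (Abs_fps (\<lambda>n. of_real (c n) :: 'a) oo fps_X ^ 2) n = of_real (fps_nth (Abs_fps c oo fps_X ^ 2) n)" for n
    by (simp add: fps_nth_compose_square)
  then show ?thesis unfolding fps_mult_nth by simp
qed

lemma pochhammer_of_real_add_of_nat:
  "pochhammer (of_real g + of_nat k) n = (of_real (pochhammer (g + of_nat k) n) :: 'a::{real_algebra_1,comm_ring_1})"
  using pochhammer_of_real[of "g + of_nat k" n, where 'a = 'a] by simp

lemma gen_coeff_of_real: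
  "gen_coeff l (\<lambda>n. of_real (c n)) (of_real g) j (\<lambda>k. of_real (f k))
   = (of_real (gen_coeff l c g j f) :: 'a::{real_normed_field,field_char_0})"
  unfolding gen_coeff_def fps_nth_exp_mult_compose_of_real pochhammer_of_real_add_of_nat by simp

text \<open>For \<open>a = mu / 2\<close> and \<open>g = (mu + 1) / 2 - l\<close> this function is
  \<open>Gen\<close> at \<open>2 * Y\<close> up to a constant, with the closed form of the Macdonald
  function inserted. The argument v = Y t/(1-t) brings one factor (1-t)^(-1), so v^r times
  (1-t)^(-g-q) contains a binomial series with parameter g+q+r, the Pochhammer base in
  \<open>gen_coeff\<close>.\<close>

lemma has_fps_expansion_Gen_complex:
  fixes g Y :: complex
  assumes "a \<ge> 0"
  shows "(\<lambda>t. \<Sum>q\<le>l. of_nat (bessel_theta l q) * Y ^ q * ((1 - t) powr (- (g + of_nat q))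
            * ((\<lambda>v. exp (- v) * besselI_complex a v) \<circ> (\<lambda>t. Y * (t * (1 - t) powr (-1)))) t))
       has_fps_expansion Abs_fps (\<lambda>j. gen_coeff l (\<lambda>n. of_real (besselI_coeff a n)) g j (\<lambda>k. Y ^ k))"
proof -
  define H where "H = fps_exp (-1) * (Abs_fps (\<lambda>n. complex_of_real (besselI_coeff a n)) oo fps_X ^ 2)"
  define U where "U = fps_const Y * (fps_X * negbinom_fps 1)"
  have U: "fps_nth U 0 = 0" by (simp add: U_def)
  have pow: "U ^ i = fps_const (Y ^ i) * (fps_X ^ i * negbinom_fps (of_nat i))" for i
    by (induction i) (simp_all add: U_def negbinom_fps_add mult_ac flip: fps_const_mult)
  have coeff: "fps_nth (negbinom_fps b * (H oo U)) j
      = (\<Sum>r\<le>j. fps_nth H r * (Y ^ r * (pochhammer (b + of_nat r) (j - r) / fact (j - r))))" for b j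
    unfolding fps_nth_mult_compose[OF U]
  proof (intro sum.cong refl)
    fix r assume r: "r \<in> {..j}"
    have "negbinom_fps b * U ^ r = fps_const (Y ^ r) * (fps_X ^ r * negbinom_fps (b + of_nat r))"
      unfolding pow negbinom_fps_add by (simp add: mult_ac)
    then show "fps_nth H r * fps_nth (negbinom_fps b * U ^ r) j
       = fps_nth H r * (Y ^ r * (pochhammer (b + of_nat r) (j - r) / fact (j - r)))"
      using r by (simp add: fps_X_power_mult_nth)
  qed
  have exp: "(\<lambda>v. exp (- v) * besselI_complex a v) has_fps_expansion H"
    unfolding H_def by (intro has_fps_expansion_mult has_fps_expansion_besselI_complex assms has_fps_expansion_exp_neg1)
  have comp: "((\<lambda>v. exp (- v) * besselI_complex a v) \<circ> (\<lambda>t. Y * (t * (1 - t) powr (-1)))) has_fps_expansion (H oo U)"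
    by (rule has_fps_expansion_compose[OF exp _ U])
       (unfold U_def, intro has_fps_expansion_cmult_left has_fps_expansion_mult has_fps_expansion_fps_X has_fps_expansion_negbinom)
  have "(\<lambda>t. \<Sum>q\<le>l. of_nat (bessel_theta l q) * Y ^ q * ((1 - t) powr (- (g + of_nat q))
            * ((\<lambda>v. exp (- v) * besselI_complex a v) \<circ> (\<lambda>t. Y * (t * (1 - t) powr (-1)))) t))
       has_fps_expansion (\<Sum>q\<le>l. fps_const (of_nat (bessel_theta l q) * Y ^ q) * (negbinom_fps (g + of_nat q) * (H oo U)))"
    by (intro has_fps_expansion_sum has_fps_expansion_cmult_left has_fps_expansion_mult comp has_fps_expansion_negbinom)
  also have "(\<Sum>q\<le>l. fps_const (of_nat (bessel_theta l q) * Y ^ q) * (negbinom_fps (g + of_nat q) * (H oo U)))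
     = Abs_fps (\<lambda>j. gen_coeff l (\<lambda>n. of_real (besselI_coeff a n)) g j (\<lambda>k. Y ^ k))"
  proof (rule fps_ext)
    fix j
    show "fps_nth (\<Sum>q\<le>l. fps_const (of_nat (bessel_theta l q) * Y ^ q) * (negbinom_fps (g + of_nat q) * (H oo U))) j
       = fps_nth (Abs_fps (\<lambda>j. gen_coeff l (\<lambda>n. of_real (besselI_coeff a n)) g j (\<lambda>k. Y ^ k))) j"
      unfolding gen_coeff_def H_def[symmetric]
      by (simp only: fps_sum_nth fps_mult_left_const_nth coeff fps_nth_Abs_fps sum_distrib_left)
         (simp add: power_add add.assoc mult_ac)
  qed
  finally show ?thesis .
qed

lemma has_fps_expansion_Gen:
  assumes mu: "mu \<ge> 0" and Y: "Y > 0"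
  shows "(\<lambda>t. Gen mu l t (2 * Y)) has_fps_expansion
    Abs_fps (\<lambda>j. sqrt pi * 2 ^ l * gen_coeff l (besselI_coeff (mu / 2)) ((mu + 1) / 2 - real l) j (\<lambda>k. Y ^ k))"
proof -
  define g where "g = (mu + 1) / 2 - real l"
  define a where "a = mu / 2"
  have a: "a \<ge> 0" using mu by (simp add: a_def)
  let ?h = "\<lambda>t::complex. \<Sum>q\<le>l. of_nat (bessel_theta l q) * of_real Y ^ q * ((1 - t) powr (- (of_real g + of_nat q))
            * ((\<lambda>v. exp (- v) * besselI_complex a v) \<circ> (\<lambda>t. of_real Y * (t * (1 - t) powr (-1)))) t)"
  have "(\<lambda>t. of_real (sqrt pi * 2 ^ l) * ?h t) has_fps_expansion fps_const (of_real (sqrt pi * 2 ^ l)) *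
     Abs_fps (\<lambda>j. gen_coeff l (\<lambda>n. of_real (besselI_coeff a n)) (of_real g) j (\<lambda>k. of_real Y ^ k))"
    by (intro has_fps_expansion_cmult_left has_fps_expansion_Gen_complex a)
  then show ?thesis
  proof (rule has_fps_expansion_of_real_transfer)
    fix n
    show "fps_nth (fps_const (of_real (sqrt pi * 2 ^ l)) *
        Abs_fps (\<lambda>j. gen_coeff l (\<lambda>n. complex_of_real (besselI_coeff a n)) (of_real g) j (\<lambda>k. of_real Y ^ k))) n
      = of_real (fps_nth (Abs_fps (\<lambda>j. sqrt pi * 2 ^ l * gen_coeff l (besselI_coeff (mu / 2)) ((mu + 1) / 2 - real l) j (\<lambda>k. Y ^ k))) n)"
      by (simp add: a_def g_def flip: gen_coeff_of_real)
  next
    have "\<forall>\<^sub>F t::real in nhds 0. t \<in> ball 0 1"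
      by (intro eventually_nhds_in_open) auto
    then show "\<forall>\<^sub>F t in nhds 0. of_real (sqrt pi * 2 ^ l) * ?h (of_real t) = of_real (Gen mu l t (2 * Y))"
    proof eventually_elim
      case (elim t)
      then have t: "1 - t > 0" by (auto simp: dist_real_def)
      define z where "z = Y / (1 - t)"
      have z: "z > 0" using Y t by (simp add: z_def)
      have powr: "(1 - of_real t) powr (- (of_real g + of_nat q)) = complex_of_real ((1 - t) powr (- g) / (1 - t) ^ q)" for q
      proof -
        have "(1 - complex_of_real t) powr (- (of_real g + of_nat q)) = of_real ((1 - t) powr (- (g + real q)))"
          using t by (subst powr_of_real[symmetric]) auto
        also have "(1 - t) powr (- (g + real q)) = (1 - t) powr (- g) / (1 - t) ^ q"
          using t by (simp add: powr_diff powr_realpow)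
        finally show ?thesis .
      qed
      have arg: "of_real Y * (of_real t * (1 - of_real t) powr (-1)) = complex_of_real (t * z)"
        using powr_of_real[of "1 - t" "-1"] t by (simp add: z_def powr_minus_divide)
      have "?h (of_real t) = (\<Sum>q\<le>l. of_real (real (bessel_theta l q) * Y ^ q * ((1 - t) powr (- g) / (1 - t) ^ q
             * (exp (- (t * z)) * besselI_tilde a (t * z)))))"
        unfolding o_def arg powr besselI_complex_of_real[OF a] by (simp flip: exp_of_real)
      also have "\<dots> = of_real ((1 - t) powr (- g) * (exp (- (t * z)) * besselI_tilde a (t * z)) *
             (\<Sum>q\<le>l. real (bessel_theta l q) * z ^ q))"
        unfolding of_real_sum[symmetric] sum_distrib_left z_def power_divide
        by (intro arg_cong[of _ _ of_real] sum.cong refl) (simp add: mult_ac)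
      finally have h: "?h (of_real t) = of_real ((1 - t) powr (- g) * (exp (- (t * z)) * besselI_tilde a (t * z)) *
             (\<Sum>q\<le>l. real (bessel_theta l q) * z ^ q))" .
      have "Gen mu l t (2 * Y) = 1 / (1 - t) powr (real l + (mu + 3) / 2) * Y ^ (2 * l + 1) * exp Y
          * besselI_tilde a (t * z) * besselK_tilde (real l + 1 / 2) z"
      proof -
        have "t * (2 * Y) / (2 * (1 - t)) = t * z" "2 * Y / (2 * (1 - t)) = z" "2 * Y / 2 = Y"
          using t by (simp_all add: z_def divide_simps)
        then show ?thesis by (simp only: Gen_def a_def)
      qed
      also have "\<dots> = sqrt pi * 2 ^ l * ((Y / z) ^ (2 * l + 1) / (1 - t) powr (real l + (mu + 3) / 2)
          * (exp Y * exp (- z)) * besselI_tilde a (t * z) * (\<Sum>q\<le>l. real (bessel_theta l q) * z ^ q))"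
        unfolding besselK_tilde_half_integer[OF z] power_divide by (simp add: mult_ac)
      \<comment> \<open>Since \<open>Y = (1 - t) * z\<close>, the prefactor \<open>exp Y\<close>
        removes everything from \<open>exp (- z)\<close> except a function of \<open>t * z\<close>,
        the argument of the Bessel function.\<close>
      also have "exp Y * exp (- z) = exp (- (t * z))"
      proof -
        have "Y = (1 - t) * z" using t by (simp add: z_def)
        then have "Y + - z = - (t * z)" by (simp add: algebra_simps)
        then show ?thesis by (simp only: exp_add[symmetric])
      qed
      \<comment> \<open>The origin of \<open>g\<close>: the \<open>2 * l + 1\<close> powers of
        \<open>Y / z = 1 - t\<close> raise the exponent from \<open>- l - (mu + 3) / 2\<close> to
        \<open>l - (mu + 1) / 2\<close>.\<close>
      also have "(Y / z) ^ (2 * l + 1) / (1 - t) powr (real l + (mu + 3) / 2) = (1 - t) powr (- g)"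
      proof -
        have "Y / z = 1 - t" using Y t by (simp add: z_def)
        then have "(Y / z) ^ (2 * l + 1) / (1 - t) powr (real l + (mu + 3) / 2)
            = (1 - t) powr (real (2 * l + 1) - (real l + (mu + 3) / 2))"
          using t by (simp only: powr_diff powr_realpow)
        also have "real (2 * l + 1) - (real l + (mu + 3) / 2) = - g"
          by (simp add: g_def field_simps)
        finally show ?thesis .
      qed
      finally show ?case unfolding h by simp
    qed
  qed
qed

theorem Mpoly_eq_gen_coeff:
  assumes mu: "mu \<ge> 0" and Y: "Y > 0"
  shows "Mpoly j mu l (2 * Y) =
     Gamma (real j + mu + 1) / (2 powr mu * Gamma (real j + (mu + 1) / 2)) * (sqrt pi * 2 ^ l)
     * gen_coeff l (besselI_coeff (mu / 2)) ((mu + 1) / 2 - real l) j (\<lambda>k. Y ^ k)"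
  unfolding Mpoly_def higher_deriv_0_eq_fps_nth[OF has_fps_expansion_Gen[OF assms]]
  by simp

section \<open>Decay of Gamma quotients on vertical lines\<close>

lemma integrable_one_plus_abs_powr:
  fixes p :: real
  assumes p: "p > 1"
  shows "integrable lborel (\<lambda>t::real. (1 + \<bar>t\<bar>) powr (- p))"
proof -
  have "set_integrable lborel (einterval (ereal 0) \<infinity>) (\<lambda>t::real. (1 + t) powr (- p))"
  proof (rule interval_integral_FTC_nonneg)
    fix t :: real
    assume "ereal 0 < ereal t"
    then show "((\<lambda>t. (1 + t) powr (1 - p) / (1 - p)) has_real_derivative (1 + t) powr (- p)) (at t)"
      using p by (auto intro!: derivative_eq_intros)
    show "isCont (\<lambda>t. (1 + t) powr (- p)) t"
      using \<open>ereal 0 < ereal t\<close> by (auto intro!: continuous_intros)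
  next
    show "(((\<lambda>t. (1 + t) powr (1 - p) / (1 - p)) \<circ> real_of_ereal) \<longlongrightarrow> 1 / (1 - p)) (at_right (ereal 0))"
      unfolding ereal_tendsto_simps using p by (auto intro!: tendsto_eq_intros)
    have "((\<lambda>t. (1 + t) powr (1 - p)) \<longlongrightarrow> 0) at_top"
      using p by (intro tendsto_neg_powr filterlim_tendsto_add_at_top[OF tendsto_const] filterlim_ident) auto
    then have "((\<lambda>t. (1 + t) powr (1 - p) / (1 - p)) \<longlongrightarrow> 0) at_top"
      by (rule tendsto_divide_zero)
    then show "(((\<lambda>t. (1 + t) powr (1 - p) / (1 - p)) \<circ> real_of_ereal) \<longlongrightarrow> 0) (at_left \<infinity>)"
      unfolding ereal_tendsto_simps .
  qed auto
  then have "set_integrable lborel {0<..} (\<lambda>t::real. (1 + \<bar>t\<bar>) powr (- p))"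
    unfolding set_integrable_def einterval_eq
    by (rule Bochner_Integration.integrable_cong[THEN iffD1, rotated -1]) (auto simp: indicator_def)
  then have "set_integrable lborel {0..} (\<lambda>t::real. (1 + \<bar>t\<bar>) powr (- p))"
    unfolding set_integrable_def
  proof (rule integrable_cong_AE_imp)
    show "AE x in lborel. indicat_real {0<..} x *\<^sub>R (1 + \<bar>x\<bar>) powr - p = indicat_real {0..} x *\<^sub>R (1 + \<bar>x\<bar>) powr - p"
      using AE_lborel_singleton[of 0] by eventually_elim (auto simp: indicator_def)
  qed measurable
  then show ?thesis
    unfolding set_integrable_def has_bochner_integral_iff
    using has_bochner_integral_even_function[of "\<lambda>t::real. (1 + \<bar>t\<bar>) powr (- p)"]
    by (auto simp: has_bochner_integral_iff)
qed

lemma norm_Complex_ge: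
  assumes "a > 0"
  shows "norm (Complex a t) \<ge> min a 1 / 2 * (1 + \<bar>t\<bar>)"
proof -
  have 1: "\<bar>t\<bar> \<le> norm (Complex a t)" "a \<le> norm (Complex a t)"
    using abs_Im_le_cmod[of "Complex a t"] complex_Re_le_cmod[of "Complex a t"] by simp_all
  show ?thesis
  proof (cases "\<bar>t\<bar> \<ge> 1")
    case True
    have "min a 1 / 2 * (1 + \<bar>t\<bar>) \<le> 1 / 2 * (1 + \<bar>t\<bar>)" by (intro mult_right_mono) auto
    also have "\<dots> \<le> \<bar>t\<bar>" using True by simp
    finally show ?thesis using 1(1) by (rule order_trans)
  next
    case False
    have "min a 1 / 2 * (1 + \<bar>t\<bar>) \<le> a / 2 * 2" using False assms by (intro mult_mono) auto
    also have "a / 2 * 2 = a" by simp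
    finally show ?thesis using 1(2) by (rule order_trans)
  qed
qed

lemma Complex_notin_nonpos_Ints: "a > 0 \<Longrightarrow> Complex a t \<notin> \<int>\<^sub>\<le>\<^sub>0"
  by (auto elim!: nonpos_Ints_cases simp: complex_eq_iff)

text \<open>In the quotient of Gauss's limit formulas for x+iy and x the factor n! n^z cancels in
  modulus, because n^(iy) has modulus 1; only the denominators remain.\<close>

lemma norm_Gamma_ratio_limit:
  assumes x: "x > 0"
  shows "(\<lambda>n. \<Prod>k\<le>n. (x + real k) / norm (Complex (x + real k) y)) \<longlonglongrightarrow> norm (Gamma (Complex x y)) / Gamma x"
proof (rule Lim_transform_eventually)
  have "Gamma x \<noteq> 0" using Gamma_real_pos[OF x] by simp
  then show "(\<lambda>n. norm (Gamma_series (Complex x y) n) / Gamma_series x n) \<longlonglongrightarrow> norm (Gamma (Complex x y)) / Gamma x"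
    by (intro tendsto_intros)
  show "\<forall>\<^sub>F n in sequentially. norm (Gamma_series (Complex x y) n) / Gamma_series x n
      = (\<Prod>k\<le>n. (x + real k) / norm (Complex (x + real k) y))"
  proof (intro always_eventually allI)
    fix n
    have "norm (pochhammer (Complex x y) (n + 1)) = (\<Prod>k\<le>n. norm (Complex (x + real k) y))"
      by (simp add: pochhammer_Suc_prod atLeast0AtMost flip: prod_norm) (simp add: Complex_eq algebra_simps)
    moreover have "pochhammer x (n + 1) = (\<Prod>k\<le>n. x + real k)"
      by (simp add: pochhammer_Suc_prod atLeast0AtMost)
    ultimately show "norm (Gamma_series (Complex x y) n) / Gamma_series x n
      = (\<Prod>k\<le>n. (x + real k) / norm (Complex (x + real k) y))"
      by (simp add: Gamma_series_def norm_mult norm_divide prod_dividef)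
  qed
qed

text \<open>By Euler's product, \<open>|Gamma(x+iy)| / Gamma x\<close> is the product of the factors
  \<open>s / |s+iy|\<close> over \<open>s = x, x+1, \<dots>\<close>. Each factor is log-concave in \<open>s\<close>, so the half step from
  \<open>Gamma z\<close> to \<open>Gamma (z+1/2)\<close> is controlled by the full step to \<open>Gamma (z+1) = z * Gamma z\<close>.\<close>

lemma Gamma_ratio_factor_log_concave:
  assumes s: "s > 0"
  shows "s / norm (Complex s y) * ((s + 1) / norm (Complex (s + 1) y)) \<le> ((s + 1/2) / norm (Complex (s + 1/2) y))\<^sup>2"
proof -
  define m where "m = (s + 1/2)\<^sup>2"
  define p where "p = s * (s + 1)"
  define Y where "Y = y\<^sup>2"
  have p: "0 < p" using s by (simp add: p_def)
  \<comment> \<open>Squared, the claim reads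
    \<open>p^2 * (m + Y)^2 \<le> m^2 * ((s^2 + Y) * ((s + 1)^2 + Y))\<close>, and this holds
    coefficient by coefficient in \<open>Y\<close>.\<close>
  have "p = m - 1/4" by (simp add: p_def m_def power2_eq_square field_simps)
  then have "p \<le> m" by simp
  have Y: "Y \<ge> 0" by (simp add: Y_def)
  have AB: "(s\<^sup>2 + Y) * ((s + 1)\<^sup>2 + Y) = p\<^sup>2 + Y * (2 * m + 1/2) + Y\<^sup>2"
    unfolding p_def m_def by (simp add: power2_eq_square field_simps)
  have pos: "s\<^sup>2 + Y > 0" "(s + 1)\<^sup>2 + Y > 0" "m + Y > 0"
    using s Y by (auto simp: m_def intro!: add_pos_nonneg)
  have "p\<^sup>2 \<le> m\<^sup>2" using p \<open>p \<le> m\<close> by (intro power_mono) auto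
  moreover have "p\<^sup>2 * (2 * m) \<le> m\<^sup>2 * (2 * m + 1/2)"
    using \<open>p\<^sup>2 \<le> m\<^sup>2\<close> \<open>p \<le> m\<close> p by (intro mult_mono) auto
  ultimately have "p\<^sup>2 * m\<^sup>2 + Y * (p\<^sup>2 * (2 * m)) + p\<^sup>2 * Y\<^sup>2 \<le> m\<^sup>2 * p\<^sup>2 + Y * (m\<^sup>2 * (2 * m + 1/2)) + m\<^sup>2 * Y\<^sup>2"
    using Y by (intro add_mono mult_left_mono mult_right_mono) auto
  then have key: "p\<^sup>2 * (m + Y)\<^sup>2 \<le> m\<^sup>2 * ((s\<^sup>2 + Y) * ((s + 1)\<^sup>2 + Y))"
    unfolding AB by (simp add: power2_eq_square algebra_simps)
  have "(p / (sqrt (s\<^sup>2 + Y) * sqrt ((s + 1)\<^sup>2 + Y)))\<^sup>2 = p\<^sup>2 / ((s\<^sup>2 + Y) * ((s + 1)\<^sup>2 + Y))"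
    using pos by (simp add: power_divide power_mult_distrib)
  also have "\<dots> \<le> m\<^sup>2 / (m + Y)\<^sup>2"
    using key pos by (simp add: divide_simps mult_ac)
  also have "\<dots> = (m / (m + Y))\<^sup>2" by (simp add: power_divide)
  finally have "p / (sqrt (s\<^sup>2 + Y) * sqrt ((s + 1)\<^sup>2 + Y)) \<le> m / (m + Y)"
    by (rule power2_le_imp_le) (use p \<open>p \<le> m\<close> pos in \<open>auto intro: divide_nonneg_pos\<close>)
  then show ?thesis
    using pos by (simp add: cmod_def power_divide p_def Y_def m_def)
qed

lemma norm_Gamma_half_step:
  assumes x: "x > 0"
  shows "norm (Gamma (Complex x y)) \<le> Gamma x / Gamma (x + 1/2) * sqrt x * norm (Gamma (Complex (x + 1/2) y)) / sqrt (norm (Complex x y))"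
proof -
  define R where "R = (\<lambda>x. norm (Gamma (Complex x y)) / Gamma x)"
  define N where "N = norm (Complex x y)"
  have N: "N > 0" using x by (simp add: N_def complex_eq_iff)
  have G: "Gamma x > 0" "Gamma (x + 1/2) > 0" using x by (auto intro!: Gamma_real_pos)
  have "R x * R (x + 1) \<le> (R (x + 1/2))\<^sup>2"
  proof (rule LIMSEQ_le)
    show "(\<lambda>n. (\<Prod>k\<le>n. (x + real k) / norm (Complex (x + real k) y)) *
               (\<Prod>k\<le>n. ((x + 1) + real k) / norm (Complex ((x + 1) + real k) y))) \<longlonglongrightarrow> R x * R (x + 1)"
      unfolding R_def using x by (intro tendsto_mult norm_Gamma_ratio_limit) auto
    show "(\<lambda>n. (\<Prod>k\<le>n. ((x + 1/2) + real k) / norm (Complex ((x + 1/2) + real k) y))\<^sup>2) \<longlonglongrightarrow> (R (x + 1/2))\<^sup>2"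
      unfolding R_def using x by (intro tendsto_power norm_Gamma_ratio_limit) auto
    have "(\<Prod>k\<le>n. (x + real k) / norm (Complex (x + real k) y)) *
               (\<Prod>k\<le>n. ((x + 1) + real k) / norm (Complex ((x + 1) + real k) y))
             \<le> (\<Prod>k\<le>n. ((x + 1/2) + real k) / norm (Complex ((x + 1/2) + real k) y))\<^sup>2" for n
      unfolding prod.distrib[symmetric] prod_power_distrib
    proof (intro prod_mono conjI)
      fix k
      show "(x + real k) / norm (Complex (x + real k) y) * (((x + 1) + real k) / norm (Complex ((x + 1) + real k) y))
        \<le> (((x + 1/2) + real k) / norm (Complex ((x + 1/2) + real k) y))\<^sup>2"
        using Gamma_ratio_factor_log_concave[of "x + real k" y] x by (simp add: add_ac)
      show "0 \<le> (x + real k) / norm (Complex (x + real k) y) * (((x + 1) + real k) / norm (Complex ((x + 1) + real k) y))"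
        using x by (intro mult_nonneg_nonneg divide_nonneg_nonneg) auto
    qed
    then show "\<exists>N. \<forall>n\<ge>N. (\<Prod>k\<le>n. (x + real k) / norm (Complex (x + real k) y)) *
               (\<Prod>k\<le>n. ((x + 1) + real k) / norm (Complex ((x + 1) + real k) y))
             \<le> (\<Prod>k\<le>n. ((x + 1/2) + real k) / norm (Complex ((x + 1/2) + real k) y))\<^sup>2"
      by blast
  qed
  \<comment> \<open>The functional equation turns the midpoint inequality into a comparison of
    \<open>N / x * (R x)^2\<close> with the square of \<open>R (x + 1/2)\<close>; its square root is
    the gain \<open>N\<close> to the power -1/2.\<close>
  also have "R (x + 1) = N / x * R x"
  proof -
    have "Gamma (Complex x y + 1) = Complex x y * Gamma (Complex x y)"
      using x by (intro Gamma_plus1) (auto simp: Complex_notin_nonpos_Ints)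
    moreover have "Gamma (x + 1) = x * Gamma x"
      using x by (intro Gamma_plus1) (auto elim!: nonpos_Ints_cases)
    moreover have "Complex x y + 1 = Complex (x + 1) y" by (simp add: complex_eq_iff)
    ultimately show ?thesis by (simp add: R_def N_def norm_mult)
  qed
  finally have "N / x * (R x)\<^sup>2 \<le> (R (x + 1/2))\<^sup>2"
    by (simp add: power2_eq_square mult_ac)
  then have "(sqrt (N / x) * R x)\<^sup>2 \<le> (R (x + 1/2))\<^sup>2"
    using N x by (simp add: power_mult_distrib)
  then have "sqrt (N / x) * R x \<le> R (x + 1/2)"
    by (rule power2_le_imp_le) (use G in \<open>auto simp: R_def\<close>)
  then have "R x \<le> R (x + 1/2) * (sqrt x / sqrt N)"
    using N x by (simp add: real_sqrt_divide field_simps)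
  then have "R x * Gamma x \<le> R (x + 1/2) * (sqrt x / sqrt N) * Gamma x"
    using G by (intro mult_right_mono) auto
  then show ?thesis using G unfolding R_def N_def by (simp add: mult_ac)
qed

lemma norm_pochhammer_ge_1:
  fixes z :: complex
  assumes "Re z \<ge> 1"
  shows "norm (pochhammer z n) \<ge> 1"
  unfolding pochhammer_prod prod_norm[symmetric]
proof (rule prod_ge_1)
  fix i
  have "1 \<le> Re (z + of_nat i)" using assms by simp
  also have "\<dots> \<le> norm (z + of_nat i)" by (rule complex_Re_le_cmod)
  finally show "1 \<le> norm (z + of_nat i)" .
qed

text \<open>The exponent 3/2 is the sum of 1/2, from the half step to z+1/2, and 1, from the factor
  1/(z+1/2). The other \<open>N\<close> factors of the denominator have modulus at least 1.\<close>

theorem Gamma_quotient_decay: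
  assumes a: "a > 0"
  obtains C where "\<And>t. norm (Gamma (Complex a t) * rGamma (Complex a t + (3/2 + of_nat N))) \<le> C * (1 + \<bar>t\<bar>) powr (- (3/2))"
proof -
  define K where "K = Gamma a / Gamma (a + 1/2) * sqrt a"
  define c where "c = min a 1 / 2"
  have K: "K \<ge> 0" unfolding K_def using a by (intro mult_nonneg_nonneg divide_nonneg_nonneg less_imp_le[OF Gamma_real_pos]) auto
  have c: "c > 0" using a by (simp add: c_def)
  have "norm (Gamma (Complex a t) * rGamma (Complex a t + (3/2 + of_nat N))) \<le> K * c powr (- (3/2)) * (1 + \<bar>t\<bar>) powr (- (3/2))" for t
  proof -
    define z where "z = Complex a t"
    define z' where "z' = Complex (a + 1/2) t"
    have z': "z' = z + 1/2" by (simp add: z_def z'_def complex_eq_iff)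
    have nz: "z \<noteq> 0" "norm z > 0" using a by (auto simp: z_def complex_eq_iff)
    have nz': "z' \<noteq> 0" "norm z' > 0" using a by (auto simp: z'_def complex_eq_iff)
    have np: "z' \<notin> \<int>\<^sub>\<le>\<^sub>0" using a by (auto simp: z'_def Complex_notin_nonpos_Ints)
    have 1: "rGamma z' = pochhammer z' (Suc N) * rGamma (z + (3/2 + of_nat N))"
      using pochhammer_rGamma[of z' "Suc N"] by (simp add: z' add_ac)
    have 2: "pochhammer z' (Suc N) = z' * pochhammer (z' + 1) N"
      by (rule pochhammer_rec)
    have "norm (pochhammer (z' + 1) N) \<ge> 1"
      using a by (intro norm_pochhammer_ge_1) (auto simp: z'_def)
    then have "norm (rGamma (z + (3/2 + of_nat N))) * norm z' * 1 \<le> norm (rGamma (z + (3/2 + of_nat N))) * norm z' * norm (pochhammer (z' + 1) N)"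
      by (intro mult_left_mono) auto
    also have "\<dots> = norm (rGamma z')"
      unfolding 1 2 by (simp add: norm_mult mult_ac)
    finally have 3: "norm (rGamma (z + (3/2 + of_nat N))) \<le> norm (rGamma z') / norm z'"
      using nz' by (simp add: field_simps)
    have "norm z \<le> norm z'"
      unfolding z_def z'_def cmod_def using a by (auto intro!: power_mono)
    have step: "norm (Gamma z) \<le> K * norm (Gamma z') / sqrt (norm z)"
      using norm_Gamma_half_step[OF a, of t] by (simp only: K_def z_def z'_def)
    have n0: "0 \<le> K * norm (Gamma z') / sqrt (norm z)"
      using K by (intro divide_nonneg_nonneg mult_nonneg_nonneg) auto
    have "norm (Gamma z * rGamma (z + (3/2 + of_nat N))) \<le> (K * norm (Gamma z') / sqrt (norm z)) * (norm (rGamma z') / norm z')"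
      unfolding norm_mult by (rule mult_mono[OF step 3 n0 norm_ge_zero])
    also have "\<dots> = K * (norm (Gamma z' * rGamma z')) / (sqrt (norm z) * norm z')"
      by (simp add: norm_mult)
    also have "Gamma z' * rGamma z' = 1"
      using np by (simp add: rGamma_inverse_Gamma Gamma_eq_zero_iff)
    also have "K * norm (1::complex) / (sqrt (norm z) * norm z') \<le> K * norm (1::complex) / (sqrt (norm z) * norm z)"
      using K nz nz' \<open>norm z \<le> norm z'\<close> by (intro divide_left_mono mult_left_mono mult_pos_pos) auto
    also have "\<dots> = K * norm z powr (- (3/2))"
    proof -
      have "norm z powr (1/2 + 1) = norm z powr (1/2) * norm z powr 1" by (rule powr_add)
      then have "norm z powr (3/2) = sqrt (norm z) * norm z" by (simp add: powr_half_sqrt)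
      then show ?thesis by (simp only: powr_minus divide_inverse norm_one mult_1_right)
    qed
    also have "\<dots> \<le> K * (c * (1 + \<bar>t\<bar>)) powr (- (3/2))"
      using norm_Complex_ge[OF a, of t] c K unfolding z_def c_def[symmetric]
      by (intro mult_left_mono powr_mono2') auto
    also have "\<dots> = K * c powr (- (3/2)) * (1 + \<bar>t\<bar>) powr (- (3/2))"
      using c by (simp add: powr_mult)
    finally show ?thesis unfolding z_def .
  qed
  then show ?thesis using that by blast
qed

section \<open>Mellin inversion of the Gamma function\<close>

lemma integral_std_normal_iexp:
  "(LINT s|lborel. complex_of_real (std_normal_density s) * iexp (v * s)) = of_real (exp (- (v\<^sup>2) / 2))"
proof -
  have "of_real (exp (- (v\<^sup>2) / 2)) = char std_normal_distribution v"
    by (simp add: char_std_normal_distribution)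
  also have "\<dots> = (LINT s|lborel. std_normal_density s *\<^sub>R iexp (v * s))"
    unfolding char_def by (subst integral_density) (auto simp: normal_density_nonneg)
  finally show ?thesis by (simp add: scaleR_conv_of_real)
qed

text \<open>The integral of \<open>F\<close> is regularised by the Gaussian factor \<open>phi (e * t)\<close> with \<open>e \<rightarrow> 0\<close>.\<close>

theorem fourier_inversion_at_0:
  fixes f :: "real \<Rightarrow> real"
  defines "F \<equiv> \<lambda>t. LINT u|lborel. complex_of_real (f u) * iexp (t * u)"
  assumes f: "integrable lborel f" and bound: "\<And>u. \<bar>f u\<bar> \<le> B" and cont: "isCont f 0"
    and F: "integrable lborel F"
  shows "(LINT t|lborel. F t) = of_real (2 * pi * f 0)"
proof -
  have [measurable]: "f \<in> borel_measurable borel" using borel_measurable_integrable[OF f] by simp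
  have [measurable]: "F \<in> borel_measurable borel" using borel_measurable_integrable[OF F] by simp
  define phi where "phi = std_normal_density"
  have phi_measurable [measurable]: "phi \<in> borel_measurable borel" by (simp add: phi_def)
  have phi_le: "0 \<le> phi t" "phi t \<le> 1" for t
  proof -
    have "1 \<le> sqrt (2 * pi)" using pi_ge_two by simp
    moreover have "exp (- t\<^sup>2 / 2) \<le> 1" by simp
    ultimately have "exp (- t\<^sup>2 / 2) / sqrt (2 * pi) \<le> 1 / 1" by (intro frac_le) auto
    then show "phi t \<le> 1" by (simp add: phi_def std_normal_density_def)
  qed (simp add: phi_def normal_density_nonneg)
  have phi_int: "integrable lborel phi" by (simp add: phi_def)
  \<comment> \<open>A Gaussian is its own Fourier transform up to scaling, so damping
    \<open>F\<close> on the scale \<open>1 / e\<close> amounts to averaging \<open>f\<close> on the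
    scale \<open>e\<close>. The damping also makes the double integral absolutely
    convergent.\<close>
  have smoothed: "(LINT t|lborel. of_real (phi (e * t)) * F t) = of_real (sqrt (2 * pi) * (LINT u|lborel. phi u * f (e * u)))"
    if e: "e > 0" for e
  proof -
    have int: "integrable (lborel \<Otimes>\<^sub>M lborel) (\<lambda>(u, t). complex_of_real (phi (e * t)) * (of_real (f u) * iexp (t * u)))"
    proof (rule lborel_pair.Fubini_integrable)
      have phi_e: "integrable lborel (\<lambda>t. phi (e * t))"
        using lborel_integrable_real_affine[OF phi_int, of e 0] e by simp
      show "integrable lborel (\<lambda>u. LINT t|lborel. norm (case (u, t) of (u, t) \<Rightarrow> complex_of_real (phi (e * t)) * (of_real (f u) * iexp (t * u))))"
        using f phi_le(1) by (simp add: norm_mult)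
      show "AE u in lborel. integrable lborel (\<lambda>t. case (u, t) of (u, t) \<Rightarrow> complex_of_real (phi (e * t)) * (of_real (f u) * iexp (t * u)))"
      proof (rule AE_I2)
        fix u
        have "integrable lborel (\<lambda>t. \<bar>f u\<bar> * phi (e * t))" using phi_e by simp
        then show "integrable lborel (\<lambda>t. case (u, t) of (u, t) \<Rightarrow> complex_of_real (phi (e * t)) * (of_real (f u) * iexp (t * u)))"
          by (rule Bochner_Integration.integrable_bound) (use phi_le(1) in \<open>auto simp: norm_mult mult.commute\<close>)
      qed
    qed measurable
    have "(LINT t|lborel. of_real (phi (e * t)) * F t)
        = (LINT t|lborel. (LINT u|lborel. complex_of_real (phi (e * t)) * (of_real (f u) * iexp (t * u))))"
      unfolding F_def by simp
    also have "\<dots> = (LINT u|lborel. (LINT t|lborel. complex_of_real (phi (e * t)) * (of_real (f u) * iexp (t * u))))"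
      using int by (rule lborel_pair.Fubini_integral)
    also have "\<dots> = (LINT u|lborel. complex_of_real (1 / e * f u * exp (- ((u / e)\<^sup>2) / 2)))"
    proof (rule Bochner_Integration.integral_cong[OF refl])
      fix u
      have "(LINT t|lborel. complex_of_real (phi (e * t)) * (of_real (f u) * iexp (t * u)))
          = of_real (f u) * (LINT t|lborel. complex_of_real (phi (0 + e * t)) * iexp (u / e * (0 + e * t)))"
        using e by (simp add: mult_ac)
      also have "(LINT t|lborel. complex_of_real (phi (0 + e * t)) * iexp (u / e * (0 + e * t)))
          = of_real (1 / e * exp (- ((u / e)\<^sup>2) / 2))"
      proof -
        have "(LINT s|lborel. complex_of_real (phi s) * iexp (u / e * s))
           = \<bar>e\<bar> *\<^sub>R (LINT t|lborel. complex_of_real (phi (0 + e * t)) * iexp (u / e * (0 + e * t)))"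
          using e by (intro lborel_integral_real_affine) auto
        then show ?thesis
          unfolding phi_def integral_std_normal_iexp using e by (simp add: scaleR_conv_of_real field_simps)
      qed
      finally show "(LINT t|lborel. complex_of_real (phi (e * t)) * (of_real (f u) * iexp (t * u)))
          = complex_of_real (1 / e * f u * exp (- ((u / e)\<^sup>2) / 2))"
        by simp
    qed
    also have "\<dots> = of_real (LINT u|lborel. 1 / e * f u * exp (- ((u / e)\<^sup>2) / 2))"
      by (rule integral_complex_of_real)
    also have "(LINT u|lborel. 1 / e * f u * exp (- ((u / e)\<^sup>2) / 2))
        = \<bar>e\<bar> *\<^sub>R (LINT u|lborel. 1 / e * f (0 + e * u) * exp (- (((0 + e * u) / e)\<^sup>2) / 2))"
      using e by (intro lborel_integral_real_affine) auto
    also have "\<dots> = (LINT u|lborel. sqrt (2 * pi) * (phi u * f (e * u)))"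
      using e by (simp add: phi_def std_normal_density_def flip: Bochner_Integration.integral_mult_right_zero)
        (simp add: mult_ac)
    finally show ?thesis by simp
  qed
  define e where "e = (\<lambda>n. inverse (real (Suc n)))"
  have e: "e \<longlonglongrightarrow> 0" "\<And>n. e n > 0"
    unfolding e_def by (rule LIMSEQ_inverse_real_of_nat) simp
  have "(\<lambda>n. LINT t|lborel. of_real (phi (e n * t)) * F t) \<longlonglongrightarrow> (LINT t|lborel. of_real (phi 0) * F t)"
  proof (rule integral_dominated_convergence)
    show "integrable lborel (\<lambda>t. norm (F t))" using F by simp
    have "isCont phi 0" unfolding phi_def std_normal_density_def by (intro continuous_intros) auto
    then have "(\<lambda>n. phi (e n * t)) \<longlonglongrightarrow> phi 0" for t
      by (rule isCont_tendsto_compose) (intro tendsto_mult_left_zero e)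
    then show "AE t in lborel. (\<lambda>n. of_real (phi (e n * t)) * F t) \<longlonglongrightarrow> of_real (phi 0) * F t"
      by (intro AE_I2 tendsto_intros)
    show "AE t in lborel. norm (of_real (phi (e n * t)) * F t) \<le> norm (F t)" for n
      using phi_le by (intro AE_I2) (auto simp: norm_mult intro!: mult_left_le_one_le)
  qed measurable
  moreover have "(\<lambda>n. complex_of_real (sqrt (2 * pi) * (LINT u|lborel. phi u * f (e n * u))))
       \<longlonglongrightarrow> of_real (sqrt (2 * pi) * (LINT u|lborel. phi u * f 0))"
  proof (intro tendsto_intros integral_dominated_convergence)
    show "integrable lborel (\<lambda>u. phi u * B)" using phi_int by simp
    have "(\<lambda>n. f (e n * u)) \<longlonglongrightarrow> f 0" for u
      using cont by (rule isCont_tendsto_compose) (intro tendsto_mult_left_zero e)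
    then show "AE u in lborel. (\<lambda>n. phi u * f (e n * u)) \<longlonglongrightarrow> phi u * f 0"
      by (intro AE_I2 tendsto_intros)
    show "AE u in lborel. norm (phi u * f (e n * u)) \<le> phi u * B" for n
      using phi_le bound by (intro AE_I2) (auto simp: abs_mult intro!: mult_left_mono)
  qed measurable
  ultimately have "(LINT t|lborel. of_real (phi 0) * F t) = of_real (sqrt (2 * pi) * (LINT u|lborel. phi u * f 0))"
    unfolding smoothed[OF e(2)] by (rule LIMSEQ_unique)
  also have "(LINT u|lborel. phi u * f 0) = f 0"
    by (simp add: phi_def)
  \<comment> \<open>The value \<open>phi 0 = 1 / sqrt (2 * pi)\<close> on the left and the factor
    \<open>sqrt (2 * pi)\<close> on the right together give \<open>2 * pi\<close>.\<close>
  finally have "of_real (1 / sqrt (2 * pi)) * (LINT t|lborel. F t) = of_real (sqrt (2 * pi) * f 0)"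
    by (simp add: phi_def std_normal_density_def)
  then have "of_real (sqrt (2 * pi)) * (of_real (1 / sqrt (2 * pi)) * (LINT t|lborel. F t))
      = of_real (sqrt (2 * pi)) * of_real (sqrt (2 * pi) * f 0)" by (rule arg_cong)
  then show ?thesis
    unfolding mult.assoc[symmetric] of_real_mult[symmetric] by simp
qed

section \<open>Gamma integrals over the half-line and Gamma on vertical lines\<close>

lemma set_integrable_lborel_iff:
  fixes f :: "real \<Rightarrow> 'a::euclidean_space"
  assumes "f \<in> borel_measurable borel" "S \<in> sets borel"
  shows "f absolutely_integrable_on S \<longleftrightarrow> set_integrable lborel S f"
  unfolding set_integrable_def by (rule integrable_completion) (use assms in measurable)

lemma borel_measurable_of_real_powr [measurable]:
  "(\<lambda>t. complex_of_real t powr s) \<in> borel_measurable borel"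
proof -
  have "(\<lambda>t. complex_of_real t powr s) = (\<lambda>t. if t = 0 then 0 else
      exp (s * (of_real (ln \<bar>t\<bar>) + (if t < 0 then pi else 0) * \<i>)))"
    by (auto simp: powr_def Ln_of_real')
  then show ?thesis by simp
qed

lemma Gamma_integral_lborel:
  assumes z: "Re z > 0"
  shows "set_integrable lborel {0<..} (\<lambda>t. complex_of_real t powr (z - 1) * of_real (exp (- t)))"
    and "(LINT t:{0<..}|lborel. complex_of_real t powr (z - 1) * of_real (exp (- t))) = Gamma z"
proof -
  have eq: "(\<lambda>t. complex_of_real t powr (z - 1) / of_real (exp t)) = (\<lambda>t. complex_of_real t powr (z - 1) * of_real (exp (- t)))"
    by (simp add: exp_minus divide_inverse)
  show int: "set_integrable lborel {0<..} (\<lambda>t. complex_of_real t powr (z - 1) * of_real (exp (- t)))"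
    using absolutely_integrable_Gamma_integral'[OF z] unfolding eq
    by (subst (asm) set_integrable_lborel_iff) auto
  then show "(LINT t:{0<..}|lborel. complex_of_real t powr (z - 1) * of_real (exp (- t))) = Gamma z"
    using Gamma_integral_complex'[OF z] unfolding eq
    by (simp add: set_borel_integral_eq_integral integral_unique)
qed

lemma Gamma_integral_scaled:
  assumes z: "Re z > 0" and b: "b > 0"
  shows "set_integrable lborel {0<..} (\<lambda>t. complex_of_real t powr (z - 1) * of_real (exp (- b * t)))"
    and "(LINT t:{0<..}|lborel. complex_of_real t powr (z - 1) * of_real (exp (- b * t))) = Gamma z / of_real b powr z"
proof -
  define f where "f = (\<lambda>t. indicator {0<..} t *\<^sub>R (complex_of_real t powr (z - 1) * of_real (exp (- t))))"
  have f: "integrable lborel f" "(LINT t|lborel. f t) = Gamma z"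
    using Gamma_integral_lborel[OF z] by (simp_all add: f_def set_integrable_def set_lebesgue_integral_def)
  have fb: "f (0 + b * t) = of_real b powr (z - 1) * (indicator {0<..} t *\<^sub>R (complex_of_real t powr (z - 1) * of_real (exp (- b * t))))" for t
    using b by (auto simp: f_def powr_times_real zero_less_mult_iff split: split_indicator)
  have nz: "complex_of_real b powr (z - 1) \<noteq> 0" using b by auto
  define h where "h = (\<lambda>t. indicator {0<..} t *\<^sub>R (complex_of_real t powr (z - 1) * of_real (exp (- b * t))))"
  have "integrable lborel (\<lambda>t. f (0 + b * t))"
    using f(1) b by (intro lborel_integrable_real_affine) auto
  then have "integrable lborel (\<lambda>t. of_real b powr (z - 1) * h t)"
    unfolding fb h_def .
  then have "integrable lborel (\<lambda>t. inverse (of_real b powr (z - 1)) * (of_real b powr (z - 1) * h t))"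
    by (rule integrable_mult_right)
  then have "integrable lborel h"
    using nz by (simp add: mult.assoc[symmetric])
  then show "set_integrable lborel {0<..} (\<lambda>t. complex_of_real t powr (z - 1) * of_real (exp (- b * t)))"
    unfolding set_integrable_def h_def .
  have "Gamma z = \<bar>b\<bar> *\<^sub>R (LINT t|lborel. f (0 + b * t))"
    unfolding f(2)[symmetric] using b by (intro lborel_integral_real_affine) auto
  also have "\<dots> = of_real b * of_real b powr (z - 1) * (LINT t:{0<..}|lborel. complex_of_real t powr (z - 1) * of_real (exp (- b * t)))"
    unfolding fb set_lebesgue_integral_def using b by (simp add: scaleR_conv_of_real)
  also have "of_real b * of_real b powr (z - 1) = complex_of_real b powr z"
    using b by (simp add: powr_diff)
  finally show "(LINT t:{0<..}|lborel. complex_of_real t powr (z - 1) * of_real (exp (- b * t))) = Gamma z / of_real b powr z"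
    using b by simp
qed

text \<open>In Gauss's limit formula each denominator satisfies |a+k+it| >= a+k, while the
  numerators agree in modulus.\<close>

lemma norm_Gamma_Complex_le:
  assumes "a > 0"
  shows "norm (Gamma (Complex a t)) \<le> Gamma a"
proof (rule LIMSEQ_le)
  show "(\<lambda>n. norm (Gamma_series (Complex a t) n)) \<longlonglongrightarrow> norm (Gamma (Complex a t))"
    by (intro tendsto_norm Gamma_series_LIMSEQ)
  show "Gamma_series a \<longlonglongrightarrow> Gamma a" by (rule Gamma_series_LIMSEQ)
  have "norm (Gamma_series (Complex a t) n) \<le> Gamma_series a n" for n
  proof -
    have p: "0 < pochhammer a (n + 1)" using assms by (rule pochhammer_pos)
    have "pochhammer a (n + 1) \<le> norm (pochhammer (Complex a t) (n + 1))"
      unfolding pochhammer_prod prod_norm[symmetric]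
    proof (intro prod_mono conjI)
      fix i
      show "a + of_nat i \<le> norm (Complex a t + of_nat i)"
        using complex_Re_le_cmod[of "Complex a t + of_nat i"] by simp
    qed (use assms in auto)
    then show ?thesis
      using p unfolding Gamma_series_def by (simp add: norm_mult norm_divide frac_le)
  qed
  then show "\<exists>N. \<forall>n\<ge>N. norm (Gamma_series (Complex a t) n) \<le> Gamma_series a n" by blast
qed

lemma measurable_Complex [measurable]: "Complex a \<in> borel_measurable borel"
proof -
  have "Complex a = (\<lambda>t. of_real a + \<i> * of_real t)" by (auto simp: complex_eq_iff)
  then show ?thesis by simp
qed

lemma continuous_on_Complex: "continuous_on S (Complex a)"
proof -
  have "Complex a = (\<lambda>t. of_real a + \<i> * of_real t)" by (auto simp: complex_eq_iff)
  then show ?thesis by (simp add: continuous_intros)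
qed

text \<open>Writing \<open>Gamma z = Gamma (z + 2) / (z * (z + 1))\<close>, with numerator bounded
  on the line, gives decay of order t^(-2), which is enough here.\<close>

lemma integrable_Gamma_vertical:
  assumes a: "a > 0"
  shows "integrable lborel (\<lambda>t. Gamma (Complex a t))"
proof (rule Bochner_Integration.integrable_bound)
  define c where "c = min a 1 / 2"
  have c: "c > 0" using a by (simp add: c_def)
  show "integrable lborel (\<lambda>t. Gamma (a + 2) / c\<^sup>2 * (1 + \<bar>t\<bar>) powr (- 2))"
    using integrable_one_plus_abs_powr[of 2] by simp
  show "(\<lambda>t. Gamma (Complex a t)) \<in> borel_measurable lborel"
  proof -
    have "{z. Re z > 0} \<inter> \<int>\<^sub>\<le>\<^sub>0 = {}" by (auto elim!: nonpos_Ints_cases)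
    then have "continuous_on UNIV (\<lambda>t. Gamma (Complex a t))"
      by (rule continuous_on_compose2[OF continuous_on_Gamma continuous_on_Complex]) (use a in auto)
    then show ?thesis by (simp add: borel_measurable_continuous_onI)
  qed
  show "AE t in lborel. norm (Gamma (Complex a t)) \<le> norm (Gamma (a + 2) / c\<^sup>2 * (1 + \<bar>t\<bar>) powr (- 2))"
  proof (rule AE_I2)
    fix t
    define z where "z = Complex a t"
    have z: "z \<noteq> 0" "z \<notin> \<int>\<^sub>\<le>\<^sub>0" using a by (auto simp: z_def complex_eq_iff Complex_notin_nonpos_Ints)
    have z1: "z + 1 \<notin> \<int>\<^sub>\<le>\<^sub>0"
      using a Complex_notin_nonpos_Ints[of "a + 1" t] by (simp add: z_def Complex_eq add_ac)
    have "Gamma (z + 1 + 1) = (z + 1) * Gamma (z + 1)" by (rule Gamma_plus1[OF z1])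
    also have "Gamma (z + 1) = z * Gamma z" by (rule Gamma_plus1[OF z(2)])
    also have "z + 1 + 1 = Complex (a + 2) t" by (simp add: z_def complex_eq_iff)
    finally have "z * (z + 1) * Gamma z = Gamma (Complex (a + 2) t)" by (simp only: mult_ac)
    then have "norm z * norm (z + 1) * norm (Gamma z) = norm (Gamma (Complex (a + 2) t))"
 by (simp only: norm_mult[symmetric])
    also have "\<dots> \<le> Gamma (a + 2)" using a by (intro norm_Gamma_Complex_le) auto
    finally have 1: "norm z * norm (z + 1) * norm (Gamma z) \<le> Gamma (a + 2)" .
    have 2: "c * (1 + \<bar>t\<bar>) \<le> norm z" unfolding c_def z_def by (rule norm_Complex_ge[OF a])
    have 3: "norm z \<le> norm (z + 1)" using a by (auto simp: z_def cmod_def intro!: power_mono)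
    have "(c * (1 + \<bar>t\<bar>)) * (c * (1 + \<bar>t\<bar>)) * norm (Gamma z) \<le> norm z * norm (z + 1) * norm (Gamma z)"
      using 2 3 c by (intro mult_right_mono mult_mono) auto
    also note 1
    finally have 4: "norm (Gamma z) * ((c * (1 + \<bar>t\<bar>)) * (c * (1 + \<bar>t\<bar>))) \<le> Gamma (a + 2)"
      by (simp only: mult.commute)
    have "0 < c * (1 + \<bar>t\<bar>)" using c by (intro mult_pos_pos) auto
    then have "0 < (c * (1 + \<bar>t\<bar>)) * (c * (1 + \<bar>t\<bar>))" by (rule mult_pos_pos) fact
    from this 4 have "norm (Gamma z) \<le> Gamma (a + 2) / ((c * (1 + \<bar>t\<bar>)) * (c * (1 + \<bar>t\<bar>)))"
      by (simp only: pos_le_divide_eq)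
    also have "\<dots> = Gamma (a + 2) / c\<^sup>2 * (1 + \<bar>t\<bar>) powr (- 2)"
    proof -
      have "(1 + \<bar>t\<bar>) powr (- 2) = 1 / (1 + \<bar>t\<bar>) ^ 2"
        by (rule powr_neg_numeral) simp
      moreover have "(c * (1 + \<bar>t\<bar>)) * (c * (1 + \<bar>t\<bar>)) = c\<^sup>2 * (1 + \<bar>t\<bar>)\<^sup>2"
        by (simp only: power2_eq_square mult_ac)
      ultimately show ?thesis by (simp only: times_divide_times_eq mult_1_right)
    qed
    also have "\<dots> \<le> norm \<dots>" unfolding real_norm_def by (rule abs_ge_self)
    finally show "norm (Gamma (Complex a t)) \<le> norm (Gamma (a + 2) / c\<^sup>2 * (1 + \<bar>t\<bar>) powr (- 2))"
      unfolding z_def .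
  qed
qed

text \<open>The exponent is maximal at \<open>u = ln (a / x)\<close>, where it equals
  \<open>a * ln (a / x) - a\<close>. The estimate follows from ln y <= y - 1, dropping the term
  \<open>- a\<close>.\<close>

lemma exp_times_exp_le:
  fixes a x u :: real
  assumes "a > 0" "x > 0"
  shows "exp (a * u - x * exp u) \<le> exp (a * ln (a / x))"
proof -
  have "ln (x * exp u / a) \<le> x * exp u / a - 1"
    using assms by (intro ln_le_minus_one) auto
  also have "ln (x * exp u / a) = u - ln (a / x)"
    using assms by (simp add: ln_div ln_mult)
  finally have "a * (u - ln (a / x)) \<le> a * (x * exp u / a - 1)"
    using assms by (intro mult_left_mono) auto
  also have "\<dots> \<le> x * exp u" using assms by (simp add: field_simps)
  finally show ?thesis by (simp add: algebra_simps)
qed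

lemma integrable_exp_minus_abs:
  assumes "b > 0"
  shows "integrable lborel (\<lambda>u::real. exp (- b * \<bar>u\<bar>))"
proof (rule Bochner_Integration.integrable_bound)
  show "integrable lborel (\<lambda>u. exp (2 * ln (2 / b) + b) * (1 + \<bar>u\<bar>) powr (- 2))"
    using integrable_one_plus_abs_powr[of 2] by simp
  show "AE u in lborel. norm (exp (- b * \<bar>u\<bar>)) \<le> norm (exp (2 * ln (2 / b) + b) * (1 + \<bar>u\<bar>) powr (- 2))"
  proof (rule AE_I2)
    fix u :: real
    \<comment> \<open>The preceding bound at the point \<open>ln (1 + |u|)\<close> compares the
      exponential with the power -2 of \<open>1 + |u|\<close>.\<close>
    have "exp (2 * ln (1 + \<bar>u\<bar>) - b * exp (ln (1 + \<bar>u\<bar>))) \<le> exp (2 * ln (2 / b))"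
      using exp_times_exp_le[of 2 b "ln (1 + \<bar>u\<bar>)"] assms by simp
    then have "2 * ln (1 + \<bar>u\<bar>) - b * (1 + \<bar>u\<bar>) \<le> 2 * ln (2 / b)"
      by simp
    then have "exp (- b * \<bar>u\<bar>) \<le> exp (2 * ln (2 / b) + b + - 2 * ln (1 + \<bar>u\<bar>))"
      by (simp add: algebra_simps)
    also have "\<dots> = exp (2 * ln (2 / b) + b) * (1 + \<bar>u\<bar>) powr (- 2)"
      unfolding exp_add[of _ "- 2 * ln (1 + \<bar>u\<bar>)"] by (simp add: powr_def)
    finally show "norm (exp (- b * \<bar>u\<bar>)) \<le> norm (exp (2 * ln (2 / b) + b) * (1 + \<bar>u\<bar>) powr (- 2))"
      by simp
  qed
qed simp

text \<open>Towards plus infinity the bound for the exponent \<open>a + 1\<close> leaves a factor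
  \<open>exp (- u)\<close>; towards minus infinity \<open>exp (a * u)\<close> decays by itself. The
  rate \<open>min a 1\<close> serves both ends.\<close>

lemma integrable_gumbel:
  assumes a: "a > 0" and x: "x > 0"
  shows "integrable lborel (\<lambda>u::real. exp (a * u - x * exp u))"
proof (rule Bochner_Integration.integrable_bound)
  define b where "b = min a 1"
  define C where "C = max 1 (exp ((a + 1) * ln ((a + 1) / x)))"
  show "integrable lborel (\<lambda>u::real. C * exp (- b * \<bar>u\<bar>))"
    using integrable_exp_minus_abs[of b] a by (simp add: b_def)
  show "AE u in lborel. norm (exp (a * u - x * exp u)) \<le> norm (C * exp (- b * \<bar>u\<bar>))"
  proof (rule AE_I2)
    fix u :: real
    have "exp (a * u - x * exp u) \<le> C * exp (- b * \<bar>u\<bar>)"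
    proof (cases "u \<ge> 0")
      case True
      have "exp (a * u - x * exp u) = exp ((a + 1) * u - x * exp u) * exp (- u)"
        by (simp add: algebra_simps flip: exp_add)
      also have "\<dots> \<le> C * exp (- u)"
        using exp_times_exp_le[of "a + 1" x u] a x unfolding C_def
        by (intro mult_right_mono max.coboundedI2) auto
      also have "\<dots> \<le> C * exp (- b * \<bar>u\<bar>)"
        using True a by (intro mult_left_mono) (auto simp: C_def b_def mult_left_le_one_le intro!: mult_left_le_one_le)
      finally show ?thesis .
    next
      case False
      then have "a * u \<le> b * u" unfolding b_def by (intro mult_right_mono_neg) auto
      moreover have "0 \<le> x * exp u" using x by simp
      ultimately have "a * u - x * exp u \<le> b * u" by linarith
      then have "a * u - x * exp u \<le> - b * \<bar>u\<bar>" using False by simp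
      then have "exp (a * u - x * exp u) \<le> 1 * exp (- b * \<bar>u\<bar>)" by simp
      also have "\<dots> \<le> C * exp (- b * \<bar>u\<bar>)" by (intro mult_right_mono) (auto simp: C_def)
      finally show ?thesis .
    qed
    also have "\<dots> \<le> norm \<dots>" unfolding real_norm_def by (rule abs_ge_self)
    finally show "norm (exp (a * u - x * exp u)) \<le> norm (C * exp (- b * \<bar>u\<bar>))" by simp
  qed
qed simp

text \<open>The Gamma integral under the substitution \<open>y = x * exp u\<close>. The scale
  \<open>x\<close> is built into the transformed function so that its value at \<open>u = 0\<close>
  is \<open>exp (- x)\<close>; Fourier inversion is then required at that single point only.\<close>

lemma Gamma_eq_fourier_integral:
  assumes a: "a > 0" and x: "x > 0"
  shows "(LINT u|lborel. complex_of_real (exp (a * u - x * exp u)) * iexp (t * u))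
    = of_real x powr (- Complex a t) * Gamma (Complex a t)"
proof -
  define z where "z = Complex a t"
  have z: "Re z > 0" using a by (simp add: z_def)
  define f where "f = (\<lambda>y. complex_of_real y powr (z - 1) * of_real (exp (- y)))"
  have eq: "(x * exp u) *\<^sub>R f (x * exp u) = of_real x powr z * (complex_of_real (exp (a * u - x * exp u)) * iexp (t * u))" for u
  proof -
    have 1: "complex_of_real (x * exp u) * complex_of_real (x * exp u) powr (z - 1) = of_real (x * exp u) powr z"
      using x by (simp add: powr_diff)
    have "complex_of_real (x * exp u) powr z = of_real x powr z * exp (z * of_real u)"
      using x unfolding powr_def Ln_of_real[OF mult_pos_pos[OF x exp_gt_zero]] Ln_of_real[OF x]
      by (simp add: ln_mult ring_distribs exp_add)
    also have "exp (z * of_real u) = of_real (exp (a * u)) * iexp (t * u)"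
      by (simp add: z_def Complex_eq ring_distribs mult_ac exp_add flip: exp_of_real)
    finally show ?thesis
      unfolding f_def scaleR_conv_of_real mult.assoc[symmetric] 1
      by (simp add: exp_diff exp_minus divide_inverse mult_ac)
  qed
  have gumbel: "integrable lborel (\<lambda>u. complex_of_real (exp (a * u - x * exp u)) * iexp (t * u))"
    by (rule Bochner_Integration.integrable_bound[OF integrable_gumbel[OF a x]]) (auto simp: norm_mult)
  have cont: "isCont f y" if "y > 0" for y
    unfolding f_def using that by (auto intro!: continuous_intros)
  have "Gamma z = (LBINT y=ereal 0..\<infinity>. f y)"
    unfolding interval_integral_to_infinity_eq f_def by (rule Gamma_integral_lborel(2)[OF z, symmetric])
  also have "\<dots> = (LBINT u=-\<infinity>..\<infinity>. (x * exp u) *\<^sub>R f (x * exp u))"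
  proof (rule interval_integral_substitution_integrable)
    have "((\<lambda>u. x * exp u) \<longlongrightarrow> x * 0) at_bot" by (intro tendsto_intros exp_at_bot)
    then show "((ereal \<circ> (\<lambda>u. x * exp u) \<circ> real_of_ereal) \<longlongrightarrow> ereal 0) (at_right (-\<infinity>))"
      unfolding ereal_tendsto_simps by simp
    show "((ereal \<circ> (\<lambda>u. x * exp u) \<circ> real_of_ereal) \<longlongrightarrow> \<infinity>) (at_left \<infinity>)"
      unfolding ereal_tendsto_simps using x
      by (intro filterlim_tendsto_pos_mult_at_top[OF tendsto_const] exp_at_top) auto
    show "set_integrable lborel (einterval (- \<infinity>) \<infinity>) (\<lambda>u. (x * exp u) *\<^sub>R f (x * exp u))"
      unfolding eq set_integrable_def using gumbel by simp
    show "set_integrable lborel (einterval (ereal 0) \<infinity>) f"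
      unfolding einterval_eq f_def by (rule Gamma_integral_lborel(1)[OF z])
  qed (use x in \<open>auto intro!: cont derivative_eq_intros continuous_intros\<close>)
  also have "\<dots> = of_real x powr z * (LINT u|lborel. complex_of_real (exp (a * u - x * exp u)) * iexp (t * u))"
    unfolding eq by (simp add: interval_lebesgue_integral_def set_lebesgue_integral_def)
  finally show ?thesis
    unfolding z_def using x by (simp add: powr_minus)
qed

theorem mellin_inversion_Gamma:
  assumes a: "a > 0" and x: "x > 0"
  shows "integrable lborel (\<lambda>t. of_real x powr (- Complex a t) * Gamma (Complex a t))"
    and "(LINT t|lborel. of_real x powr (- Complex a t) * Gamma (Complex a t)) = of_real (2 * pi * exp (- x))"
proof -
  show int: "integrable lborel (\<lambda>t. of_real x powr (- Complex a t) * Gamma (Complex a t))"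
  proof (rule Bochner_Integration.integrable_bound)
    show "integrable lborel (\<lambda>t. of_real (x powr (- a)) * Gamma (Complex a t))"
      using integrable_Gamma_vertical[OF a] by simp
    have "(\<lambda>t. of_real x powr (- Complex a t)) \<in> borel_measurable borel"
      unfolding powr_def by measurable
    then show "(\<lambda>t. of_real x powr (- Complex a t) * Gamma (Complex a t)) \<in> borel_measurable lborel"
      using borel_measurable_integrable[OF integrable_Gamma_vertical[OF a]] by simp
  qed (use x in \<open>auto simp: norm_mult norm_powr_real_powr\<close>)
  show "(LINT t|lborel. of_real x powr (- Complex a t) * Gamma (Complex a t)) = of_real (2 * pi * exp (- x))"
    using fourier_inversion_at_0[OF integrable_gumbel[OF a x], of "exp (a * ln (a / x))"] exp_times_exp_le[OF a x] int
    unfolding Gamma_eq_fourier_integral[OF a x] by simp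
qed

section \<open>The Mellin--Barnes integral\<close>

text \<open>The integrand of the G-function without the power of \<open>z\<close>. The parameters
  stay unsimplified so that \<open>meijerG20_04_line\<close> unfolds to it, up to
  \<open>0 - s = - s\<close>.\<close>

definition meijer_kernel :: "nat \<Rightarrow> real \<Rightarrow> complex \<Rightarrow> complex" where
  "meijer_kernel l M s = Gamma (- s) * Gamma (of_real (- real l - 1/2) - s)
     * rGamma (1 - of_real (- M / 2) + s) * rGamma (1 - of_real (- real l - (M + 1) / 2) + s)"

lemma Re_pos_notin_nonpos_Ints: "Re z > 0 \<Longrightarrow> z \<notin> \<int>\<^sub>\<le>\<^sub>0"
  by (auto elim!: nonpos_Ints_cases)

lemma pochhammer_nonzero_if_Re_pos:
  fixes z :: complex
  assumes "Re z > 0"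
  shows "pochhammer z n \<noteq> 0"
proof
  assume "pochhammer z n = 0"
  then obtain k where "z = - of_nat k" by (auto simp: pochhammer_eq_0_iff)
  then show False using assms by simp
qed

lemma meijer_kernel_duplication:
  assumes w: "w = 2 * s + of_real M + 2" "Re w > 0"
    and w': "w' = - 2 * s - 2 * of_nat l - 1" "Re w' > 0"
  shows "pochhammer ((w + 1) / 2) l * meijer_kernel l M s
       = pochhammer ((w' + 1) / 2) l * (2 powr (w - w') * Gamma w' * rGamma w)"
proof -
  define p where "p = pochhammer ((w' + 1) / 2) l"
  \<comment> \<open>Once \<open>l\<close> unit steps are split off, the arguments form two pairs
    with difference 1/2. The unit steps become the Pochhammer symbols, and the pairs are merged by
    duplication.\<close>
  have args: "- s = (w' + 1) / 2 + of_nat l" "of_real (- real l - 1/2) - s = w' / 2"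
    "1 - of_real (- M / 2) + s = w / 2" "1 - of_real (- real l - (M + 1) / 2) + s = (w + 1) / 2 + of_nat l"
    unfolding w(1) w'(1) by (simp_all add: field_simps)
  have np: "(w' + 1) / 2 \<notin> \<int>\<^sub>\<le>\<^sub>0" "w' / 2 \<notin> \<int>\<^sub>\<le>\<^sub>0" "w' / 2 + 1 / 2 \<notin> \<int>\<^sub>\<le>\<^sub>0" "w / 2 \<notin> \<int>\<^sub>\<le>\<^sub>0" "w / 2 + 1 / 2 \<notin> \<int>\<^sub>\<le>\<^sub>0" "w \<notin> \<int>\<^sub>\<le>\<^sub>0"
    using w(2) w'(2) by (intro Re_pos_notin_nonpos_Ints; simp)+
  have nz: "Gamma ((w' + 1) / 2) \<noteq> 0" "Gamma w \<noteq> 0"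
    using np by (auto simp: Gamma_eq_zero_iff)
  have half: "(w + 1) / 2 = w / 2 + 1 / 2" "(w' + 1) / 2 = w' / 2 + 1 / 2"
    by (simp_all add: add_divide_distrib)
  have two: "2 powr z = exp (z * of_real (ln 2))" for z :: complex
    by (simp add: powr_def Ln_of_real[of 2, simplified])
  have 1: "Gamma (- s) = p * Gamma ((w' + 1) / 2)"
    unfolding args p_def using pochhammer_Gamma[OF np(1), of l] nz by simp
  have 2: "rGamma ((w + 1) / 2) = pochhammer ((w + 1) / 2) l * rGamma ((w + 1) / 2 + of_nat l)"
    by (rule pochhammer_rGamma)
  have 3: "Gamma (w' / 2) * Gamma ((w' + 1) / 2) = exp ((1 - w') * of_real (ln 2)) * of_real (sqrt pi) * Gamma w'"
    unfolding half using Gamma_legendre_duplication[OF np(2) np(3)] by simp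
  have 4: "Gamma (w / 2) * Gamma ((w + 1) / 2) = exp ((1 - w) * of_real (ln 2)) * of_real (sqrt pi) * Gamma w"
    unfolding half using Gamma_legendre_duplication[OF np(4) np(5)] by simp
  have "rGamma (w / 2) * rGamma ((w + 1) / 2) = inverse (Gamma (w / 2) * Gamma ((w + 1) / 2))"
    by (simp add: rGamma_inverse_Gamma)
  also have "\<dots> = inverse (exp ((1 - w) * of_real (ln 2))) * inverse (of_real (sqrt pi)) * rGamma w"
    unfolding 4 by (simp add: rGamma_inverse_Gamma)
  finally have 5: "rGamma (w / 2) * rGamma ((w + 1) / 2) = inverse (exp ((1 - w) * of_real (ln 2))) * inverse (of_real (sqrt pi)) * rGamma w" .
  have 6: "exp ((1 - w') * of_real (ln 2)) * inverse (exp ((1 - w) * of_real (ln 2))) = 2 powr (w - w')"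
    unfolding two by (simp add: algebra_simps flip: exp_minus exp_add)
  have "pochhammer ((w + 1) / 2) l * meijer_kernel l M s
      = p * (Gamma (w' / 2) * Gamma ((w' + 1) / 2)) * (rGamma (w / 2) * (pochhammer ((w + 1) / 2) l * rGamma ((w + 1) / 2 + of_nat l)))"
    unfolding meijer_kernel_def 1 args(2-4) by (simp add: mult_ac)
  also have "\<dots> = p * ((exp ((1 - w') * of_real (ln 2)) * inverse (exp ((1 - w) * of_real (ln 2))))
      * (of_real (sqrt pi) * inverse (of_real (sqrt pi))) * Gamma w' * rGamma w)"
    unfolding 2[symmetric] 3 5 by (simp only: mult_ac)
  also have "\<dots> = p * (2 powr (w - w') * Gamma w' * rGamma w)"
    unfolding 6 by simp
  finally show ?thesis unfolding p_def .
qed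

section \<open>Absolute convergence along the contour and interchange of integrals\<close>

lemma norm_pochhammer_mono:
  assumes "0 \<le> Re z" "Re z \<le> Re z'" "\<bar>Im z\<bar> \<le> \<bar>Im z'\<bar>"
  shows "norm (pochhammer z n) \<le> norm (pochhammer z' n)"
  unfolding pochhammer_prod prod_norm[symmetric]
proof (intro prod_mono conjI)
  fix i
  show "norm (z + of_nat i) \<le> norm (z' + of_nat i)"
    unfolding cmod_def using assms by (intro real_sqrt_le_mono add_mono) (auto intro!: power_mono abs_le_square_iff[THEN iffD1])
qed simp

text \<open>The value of \<open>c\<close> is the midpoint prescribed by \<open>meijerG20_04\<close>.
  On this line the Pochhammer quotient of \<open>meijer_kernel_duplication\<close> has modulus at
  most 1, as the real part of \<open>w'\<close> is positive and below that of \<open>w\<close> and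
  the imaginary parts differ only in sign. The Gamma quotient supplies the decay.\<close>

lemma meijer_kernel_integrable:
  fixes l N :: nat and M c :: real
  assumes M: "M = 2 * real l + 1 + 2 * real N" and c: "c = - (3 * real l / 4) - 1 / 2 - M / 8"
  shows "integrable lborel (\<lambda>t. meijer_kernel l M (Complex c t))"
proof -
  define a where "a = M / 4 - real l / 2"
  have a: "a > 0" using M by (simp add: a_def)
  obtain C where C: "\<And>t. norm (Gamma (Complex a t) * rGamma (Complex a t + (3/2 + of_nat N))) \<le> C * (1 + \<bar>t\<bar>) powr (- (3/2))"
    using Gamma_quotient_decay[OF a, of N] by blast
  have C0: "C \<ge> 0"
    using order_trans[OF norm_ge_zero C[of 0]] by simp
  define K where "K = 2 powr (3/2 + real N)"
  show ?thesis
  proof (rule Bochner_Integration.integrable_bound)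
    show "integrable lborel (\<lambda>t::real. K * C * (1 + \<bar>t\<bar>) powr (- (3/2)))"
      using integrable_one_plus_abs_powr[of "3/2"] by simp
    show "(\<lambda>t. meijer_kernel l M (Complex c t)) \<in> borel_measurable lborel"
    proof -
      have disj: "{z. Re z > 0} \<inter> \<int>\<^sub>\<le>\<^sub>0 = {}" by (auto elim!: nonpos_Ints_cases)
      have cont: "continuous_on UNIV (\<lambda>t. Gamma (b - Complex c t))" if "Re b > c" for b
        by (rule continuous_on_compose2[OF continuous_on_Gamma[OF disj]])
           (use that in \<open>auto intro!: continuous_intros continuous_on_Complex\<close>)
      have "c < - real l - 1/2" using c a by (simp add: a_def)
      then have "continuous_on UNIV (\<lambda>t. Gamma (0 - Complex c t))"
        "continuous_on UNIV (\<lambda>t. Gamma (of_real (- real l - 1/2) - Complex c t))"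
        using cont[of 0] cont[of "of_real (- real l - 1/2)"] by (simp_all del: of_real_diff of_real_minus)
      moreover have "continuous_on UNIV (\<lambda>t. rGamma (b + Complex c t))" for b
        by (rule continuous_on_compose2[OF continuous_on_rGamma]) (auto intro!: continuous_intros continuous_on_Complex)
      ultimately have "continuous_on UNIV (\<lambda>t. meijer_kernel l M (Complex c t))"
        unfolding meijer_kernel_def diff_0 by (intro continuous_on_mult)
      then show ?thesis by (simp add: borel_measurable_continuous_onI)
    qed
    show "AE t in lborel. norm (meijer_kernel l M (Complex c t)) \<le> norm (K * C * (1 + \<bar>t\<bar>) powr (- (3/2)))"
    proof (rule AE_I2)
      fix t
      define s where "s = Complex c t"
      define w where "w = 2 * s + of_real M + 2"
      define w' where "w' = - 2 * s - 2 * of_nat l - 1"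
      have w'_eq: "w' = Complex a (- 2 * t)"
        by (simp add: w'_def s_def complex_eq_iff a_def c)
      have w_eq: "w = cnj w' + (3/2 + of_nat N)"
        by (simp add: w_def w'_def s_def complex_eq_iff c M field_simps)
      have Re: "Re w' = a" "Re w = a + (3/2 + real N)" "Im w = - Im w'" by (simp_all add: w_eq w'_eq)
      define P where "P = norm (pochhammer ((w + 1) / 2) l)"
      have P: "P > 0"
        unfolding P_def zero_less_norm_iff using a Re by (intro pochhammer_nonzero_if_Re_pos) simp
      have "P * norm (meijer_kernel l M s) = norm (pochhammer ((w' + 1) / 2) l) * (norm (2 powr (w - w')) * norm (Gamma w' * rGamma w))"
        unfolding P_def norm_mult[symmetric] using Re a
        by (subst meijer_kernel_duplication[OF w_def _ w'_def]) (simp_all add: mult_ac)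
      also have "\<dots> \<le> P * (norm (2 powr (w - w')) * norm (Gamma w' * rGamma w))"
        unfolding P_def using Re a by (intro mult_right_mono norm_pochhammer_mono) auto
      finally have "norm (meijer_kernel l M s) \<le> norm (2 powr (w - w')) * norm (Gamma w' * rGamma w)"
        using P by simp
      also have "norm (2 powr (w - w')) = K"
        by (simp add: norm_powr_real_powr Re K_def)
      \<comment> \<open>\<open>w\<close> is the conjugate of \<open>w'\<close> shifted by
        \<open>3/2 + N\<close>. Conjugation does not change the modulus, so numerator and
        denominator are brought to the same height.\<close>
      also have "norm (Gamma w' * rGamma w) = norm (Gamma w' * rGamma (w' + (3/2 + of_nat N)))"
      proof -
        have "rGamma w = cnj (rGamma (w' + (3/2 + of_nat N)))"
          unfolding w_eq cnj_rGamma by simp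
        then show ?thesis by (simp add: norm_mult)
      qed
      also have "K * \<dots> \<le> K * (C * (1 + \<bar>t\<bar>) powr (- (3/2)))"
      proof (intro mult_left_mono)
        have "norm (Gamma w' * rGamma (w' + (3/2 + of_nat N))) \<le> C * (1 + \<bar>- 2 * t\<bar>) powr (- (3/2))"
          unfolding w'_eq by (rule C)
        also have "\<dots> \<le> C * (1 + \<bar>t\<bar>) powr (- (3/2))"
          using C0 by (intro mult_left_mono powr_mono2') (auto simp: abs_mult)
        finally show "norm (Gamma w' * rGamma (w' + (3/2 + of_nat N))) \<le> C * (1 + \<bar>t\<bar>) powr (- (3/2))" .
      qed (simp add: K_def)
      also have "\<dots> \<le> norm (K * C * (1 + \<bar>t\<bar>) powr (- (3/2)))"
        unfolding real_norm_def mult.assoc[symmetric] by (rule abs_ge_self)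
      finally show "norm (meijer_kernel l M (Complex c t)) \<le> norm (K * C * (1 + \<bar>t\<bar>) powr (- (3/2)))"
        unfolding s_def .
    qed
  qed
qed

text \<open>On the contour the modulus of (xy)^(2s) is (xy)^(2c), independent of \<open>t\<close>.
  The double integral is therefore dominated by a function of \<open>t\<close> times a function of
  \<open>y\<close>, both integrable by assumption.\<close>

lemma mellin_barnes_fubini:
  fixes F :: "real \<Rightarrow> complex" and h :: "real \<Rightarrow> real"
  assumes F: "integrable lborel F" and x: "x > 0"
    and h: "set_integrable lborel {0<..} (\<lambda>y. y powr (2 * c) * h y)"
  shows "set_integrable lborel {0<..}
      (\<lambda>y. (LINT t|lborel. F t * of_real ((x * y)\<^sup>2) powr Complex c t) * of_real (h y))" (is ?int)
    and "(LINT y:{0<..}|lborel. (LINT t|lborel. F t * of_real ((x * y)\<^sup>2) powr Complex c t) * of_real (h y))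
      = (LINT t|lborel. F t * of_real x powr (2 * Complex c t)
           * (LINT y:{0<..}|lborel. of_real y powr (2 * Complex c t) * of_real (h y)))" (is "?l = ?r")
proof -
  define k where "k = (\<lambda>y. indicator {0<..} y *\<^sub>R (y powr (2 * c) * h y))"
  have k: "integrable lborel k" using h by (simp add: k_def set_integrable_def)
  have [measurable]: "k \<in> borel_measurable borel" "F \<in> borel_measurable borel"
    using borel_measurable_integrable[OF k] borel_measurable_integrable[OF F] by simp_all
  \<comment> \<open>With \<open>iexp\<close> and a real logarithm the integrand is visibly jointly
    measurable; the indicator inside \<open>k\<close> masks the values of \<open>ln\<close> at
    nonpositive \<open>y\<close>.\<close>
  define Phi where "Phi = (\<lambda>y t. of_real (x powr (2 * c)) * (F t * of_real (k y)) * iexp (t * (2 * ln (x * y))))"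
  have powr: "complex_of_real y powr (2 * Complex c t) = of_real (y powr (2 * c)) * iexp (t * (2 * ln y))" if "y > 0" for y t
    using that by (simp add: powr_def Ln_of_real Complex_eq algebra_simps exp_add flip: exp_of_real)
  have square: "complex_of_real ((x * y)\<^sup>2) powr Complex c t = of_real (x * y) powr (2 * Complex c t)" if "y > 0" for y t
    using that x by (simp only: powr_def Ln_of_real[OF zero_less_power] Ln_of_real mult_pos_pos) (simp add: ln_realpow mult_ac)
  have Phi: "Phi y t = indicator {0<..} y *\<^sub>R (F t * of_real ((x * y)\<^sup>2) powr Complex c t * of_real (h y))" for y t
  proof (cases "y > 0")
    case True
    then show ?thesis
      unfolding square[OF True] powr[OF mult_pos_pos[OF x True]]
      using x by (simp add: Phi_def k_def powr_mult mult_ac)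
  qed (simp add: Phi_def k_def)
  have norm_Phi: "norm (Phi y t) = x powr (2 * c) * norm (F t) * \<bar>k y\<bar>" for y t
    by (simp add: Phi_def norm_mult)
  have int: "integrable (lborel \<Otimes>\<^sub>M lborel) (\<lambda>(y, t). Phi y t)"
  proof (rule lborel_pair.Fubini_integrable)
    show "(\<lambda>(y, t). Phi y t) \<in> borel_measurable (lborel \<Otimes>\<^sub>M lborel)"
      unfolding Phi_def by measurable
    show "integrable lborel (\<lambda>y. LINT t|lborel. norm (case (y, t) of (y, t) \<Rightarrow> Phi y t))"
      using k by (simp add: norm_Phi)
    show "AE y in lborel. integrable lborel (\<lambda>t. case (y, t) of (y, t) \<Rightarrow> Phi y t)"
    proof (rule AE_I2)
      fix y
      have "integrable lborel (\<lambda>t. x powr (2 * c) * norm (F t) * \<bar>k y\<bar>)" using F by simp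
      moreover have "(\<lambda>t. Phi y t) \<in> borel_measurable lborel" unfolding Phi_def by measurable
      ultimately show "integrable lborel (\<lambda>t. case (y, t) of (y, t) \<Rightarrow> Phi y t)"
        unfolding prod.case by (rule Bochner_Integration.integrable_bound) (simp add: norm_Phi abs_mult)
    qed
  qed
  have inner: "(LINT t|lborel. Phi y t)
      = indicator {0<..} y *\<^sub>R ((LINT t|lborel. F t * of_real ((x * y)\<^sup>2) powr Complex c t) * of_real (h y))" for y
    unfolding Phi by simp
  have "integrable lborel (\<lambda>y. LINT t|lborel. Phi y t)"
    using lborel_pair.integrable_fst'[OF int] by simp
  then show ?int unfolding inner set_integrable_def .
  have "?l = (LINT y|lborel. (LINT t|lborel. Phi y t))"
    unfolding inner set_lebesgue_integral_def ..
  also have "\<dots> = (LINT t|lborel. (LINT y|lborel. Phi y t))"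
    using int by (rule lborel_pair.Fubini_integral[symmetric])
  also have "\<dots> = ?r"
  proof (rule Bochner_Integration.integral_cong[OF refl])
    fix t
    have *: "Phi y t = F t * of_real x powr (2 * Complex c t) * (indicator {0<..} y *\<^sub>R (of_real y powr (2 * Complex c t) * of_real (h y)))" for y
    proof (cases "y > 0")
      case True
      then have "complex_of_real ((x * y)\<^sup>2) powr Complex c t = of_real x powr (2 * Complex c t) * of_real y powr (2 * Complex c t)"
        unfolding square[OF True] using x by (simp add: powr_times_real)
      then show ?thesis by (simp only: Phi scaleR_conv_of_real mult_ac)
    qed (simp add: Phi)
    show "(LINT y|lborel. Phi y t) = F t * of_real x powr (2 * Complex c t)
           * (LINT y:{0<..}|lborel. of_real y powr (2 * Complex c t) * of_real (h y))"
      unfolding * set_lebesgue_integral_def by (rule integral_mult_right_zero)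
  qed
  finally show "?l = ?r" .
qed

section \<open>Mellin transforms of the weighted polynomials\<close>

definition gen_weight :: "nat \<Rightarrow> real \<Rightarrow> nat \<Rightarrow> nat \<times> nat \<Rightarrow> real" where
  "gen_weight l M j = (\<lambda>(q, r). real (bessel_theta l q)
       * fps_nth (fps_exp (-1) * (Abs_fps (besselI_coeff (M / 2)) oo fps_X ^ 2)) r
       * (pochhammer ((M + 1) / 2 - real l + of_nat (q + r)) (j - r) / fact (j - r)))"


text \<open>The weights are real and independent of \<open>f\<close>. Hence the weights that expand
  \<open>Mpoly\<close> in powers of \<open>2 * y\<close> also express its Mellin transform, with
  Pochhammer symbols in place of powers.\<close>

lemma gen_coeff_eq_sum_weight:
  fixes f :: "nat \<Rightarrow> 'a::{real_normed_field,field_char_0}"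
  shows "gen_coeff l (\<lambda>n. of_real (besselI_coeff (M / 2) n)) (of_real ((M + 1) / 2 - real l)) j f
       = (\<Sum>i\<in>{..l} \<times> {..j}. of_real (gen_weight l M j i) * f (fst i + snd i))"
  unfolding gen_coeff_def gen_weight_def fps_nth_exp_mult_compose_of_real
    pochhammer_of_real_add_of_nat sum.cartesian_product
  by (intro sum.cong refl) auto

lemma gen_coeff_real_eq_sum_weight:
  "gen_coeff l (besselI_coeff (M / 2)) ((M + 1) / 2 - real l) j f
     = (\<Sum>i\<in>{..l} \<times> {..j}. gen_weight l M j i * f (fst i + snd i))"
  using gen_coeff_eq_sum_weight[of l M j f] by simp

text \<open>The \<open>fact j\<close> of \<open>Mpoly\<close> has cancelled against the Taylor
  coefficient; \<open>sqrt pi * 2 ^ l\<close> stems from the closed form of the Macdonald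
  function.\<close>

definition Mpoly_const :: "nat \<Rightarrow> real \<Rightarrow> nat \<Rightarrow> real" where
  "Mpoly_const j M l = Gamma (real j + M + 1) / (2 powr M * Gamma (real j + (M + 1) / 2)) * (sqrt pi * 2 ^ l)"

lemma Mpoly_eq_sum_weight:
  assumes "M \<ge> 0" "y > 0"
  shows "Mpoly j M l (4 * y)
    = Mpoly_const j M l * (\<Sum>i\<in>{..l} \<times> {..j}. gen_weight l M j i * (2 * y) ^ (fst i + snd i))"
  using Mpoly_eq_gen_coeff[OF assms(1), of "2 * y" j l] assms(2)
  unfolding gen_coeff_real_eq_sum_weight Mpoly_const_def by simp

definition weight_pochhammer :: "nat \<Rightarrow> real \<Rightarrow> nat \<Rightarrow> complex \<Rightarrow> complex" where
  "weight_pochhammer l M j w = (\<Sum>i\<in>{..l} \<times> {..j}. of_real (gen_weight l M j i) * pochhammer w (fst i + snd i))"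

lemma weight_pochhammer_functional_equation:
  assumes M: "M \<ge> 0" and w: "w + w' = of_real (M + 1 - 2 * real l)"
  shows "pochhammer ((w' + 1) / 2) l * weight_pochhammer l M j w
       = (-1) ^ j * (pochhammer ((w + 1) / 2) l * weight_pochhammer l M j w')"
  unfolding weight_pochhammer_def gen_coeff_eq_sum_weight[symmetric]
proof (rule gen_coeff_functional_equation)
  show "complex_of_real (besselI_coeff (M / 2) n)
      = of_real (rGamma (M / 2 + 1)) / (4 ^ n * fact n * pochhammer (of_real (M / 2) + 1) n)" for n
    using pochhammer_of_real[of "M / 2 + 1" n, where 'a = complex] by (simp add: besselI_coeff_def)
  show "complex_of_real (M / 2) + 1 + of_nat n \<noteq> 0" for n
    using M by (simp add: complex_eq_iff)
  show "complex_of_real ((M + 1) / 2 - real l) = of_real (M / 2) + 1 / 2 - of_nat l"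
    by (simp add: add_divide_distrib)
  show "w + w' = 2 * complex_of_real ((M + 1) / 2 - real l)"
    unfolding w by (simp add: field_simps)
qed

definition Mpoly_weighted :: "nat \<Rightarrow> real \<Rightarrow> nat \<Rightarrow> real \<Rightarrow> real" where
  "Mpoly_weighted j M l y = exp (- 2 * y) * y powr (M + 1) * Mpoly j M l (4 * y)"

text \<open>In \<open>w = 2 * s + M + 2\<close> the weight contributes \<open>M + 1\<close> and the
  usual exponent shift of a Mellin transform the last 1. A monomial (2y)^d gives 2^d Gamma(w+d) /
  2^(w+d), which is 2^(-w) Gamma(w) times (w)_d.\<close>

lemma Mpoly_mellin_transform:
  fixes s w :: complex
  assumes M: "M \<ge> 0" and w: "w = 2 * s + of_real M + 2" "Re w > 0"
  shows "set_integrable lborel {0<..} (\<lambda>y. of_real y powr (2 * s) * of_real (Mpoly_weighted j M l y))" (is ?int)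
    and "(LINT y:{0<..}|lborel. of_real y powr (2 * s) * of_real (Mpoly_weighted j M l y))
       = of_real (Mpoly_const j M l) * (2 powr (- w) * Gamma w * weight_pochhammer l M j w)" (is "?l = ?r")
proof -
  let ?I = "{..l} \<times> {..j}"
  define d where "d = (\<lambda>i::nat \<times> nat. fst i + snd i)"
  define K where "K = (\<lambda>i. complex_of_real (Mpoly_const j M l * gen_weight l M j i * 2 ^ d i))"
  define e where "e = (\<lambda>i y. complex_of_real y powr (w + of_nat (d i) - 1) * of_real (exp (- 2 * y)))"
  have e: "set_integrable lborel {0<..} (e i)"
    "(LINT y:{0<..}|lborel. e i y) = Gamma (w + of_nat (d i)) / 2 powr (w + of_nat (d i))" for i
    unfolding e_def using Gamma_integral_scaled[of "w + of_nat (d i)" 2] w(2) by simp_all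
  have eq: "of_real y powr (2 * s) * of_real (Mpoly_weighted j M l y) = (\<Sum>i\<in>?I. K i * e i y)" if "y > 0" for y
  proof -
    have "complex_of_real y powr (2 * s) * of_real (y powr (M + 1)) * of_real y ^ n = of_real y powr (w + of_nat n - 1)" for n
    proof -
      have "complex_of_real (y powr (M + 1)) = of_real y powr of_real (M + 1)"
        using that by (intro powr_of_real[symmetric]) simp
      moreover have "complex_of_real y ^ n = of_real y powr of_nat n"
        using that by simp
      moreover have "w + of_nat n - 1 = 2 * s + of_real (M + 1) + of_nat n"
        by (simp add: w(1))
      ultimately show ?thesis by (simp only: powr_add)
    qed
    then have "K i * e i y = of_real y powr (2 * s) * of_real (exp (- 2 * y) * y powr (M + 1)
        * (Mpoly_const j M l * (gen_weight l M j i * (2 * y) ^ d i)))" for i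
      unfolding K_def e_def by (simp add: power_mult_distrib mult_ac flip: \<open>\<And>n. _ = of_real y powr (w + of_nat n - 1)\<close>)
    then show ?thesis
      unfolding Mpoly_weighted_def Mpoly_eq_sum_weight[OF M that]
      by (simp add: d_def sum_distrib_left)
  qed
  have ind: "indicator {0<..} y *\<^sub>R (\<Sum>i\<in>?I. K i * e i y) = (\<Sum>i\<in>?I. K i * (indicator {0<..} y *\<^sub>R e i y))" for y
    by (simp add: scaleR_sum_right)
  have summand: "integrable lborel (\<lambda>y. K i * (indicator {0<..} y *\<^sub>R e i y))" for i
    using e(1)[of i] unfolding set_integrable_def by (rule integrable_mult_right)
  have int: "set_integrable lborel {0<..} (\<lambda>y. \<Sum>i\<in>?I. K i * e i y)"
    unfolding set_integrable_def ind by (rule Bochner_Integration.integrable_sum[OF summand])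
  then show ?int
    by (subst set_integrable_cong[OF refl refl eq]) auto
  have "?l = (LINT y:{0<..}|lborel. \<Sum>i\<in>?I. K i * e i y)"
    by (intro set_lebesgue_integral_cong) (auto simp: eq)
  also have "\<dots> = (\<Sum>i\<in>?I. K i * (Gamma (w + of_nat (d i)) / 2 powr (w + of_nat (d i))))"
    unfolding e(2)[symmetric] set_lebesgue_integral_def ind
    by (subst Bochner_Integration.integral_sum[OF summand]) (simp only: integral_mult_right_zero)
  also have "\<dots> = ?r"
    unfolding weight_pochhammer_def sum_distrib_left
  proof (intro sum.cong refl)
    fix i
    have "w \<notin> \<int>\<^sub>\<le>\<^sub>0" using w(2) by (rule Re_pos_notin_nonpos_Ints)
    then have "Gamma (w + of_nat (d i)) = pochhammer w (d i) * Gamma w"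
      by (subst pochhammer_Gamma) (simp_all add: Gamma_eq_zero_iff)
    moreover have "2 powr (w + of_nat (d i)) = 2 powr w * 2 ^ d i" by (simp add: powr_add)
    ultimately show "K i * (Gamma (w + of_nat (d i)) / 2 powr (w + of_nat (d i)))
       = of_real (Mpoly_const j M l) * (2 powr (- w) * Gamma w * (of_real (gen_weight l M j i) * pochhammer w (fst i + snd i)))"
      by (simp add: K_def powr_minus divide_inverse d_def[symmetric] mult_ac) (simp add: d_def)
  qed
  finally show "?l = ?r" .
qed

text \<open>The change of variable \<open>-2 * t\<close> reduces this to inversion on the line at
  \<open>a + d\<close>. Moving the argument by \<open>d\<close> costs the factor
  \<open>(2 * x) ^ d\<close>, and the scaling halves \<open>2 * pi\<close>.\<close>

lemma mellin_inversion_shifted_Gamma: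
  fixes x a :: real and d :: nat
  assumes a: "a > 0" and x: "x > 0"
  defines "f \<equiv> \<lambda>t. complex_of_real x powr (- Complex a (- 2 * t)) * 2 powr (- Complex a (- 2 * t)) * Gamma (Complex a (- 2 * t) + of_nat d)"
  shows "integrable lborel f" and "(LINT t|lborel. f t) = of_real (pi * (2 * x) ^ d * exp (- 2 * x))"
proof -
  define g where "g = (\<lambda>t. of_real (2 * x) powr (- Complex (a + real d) t) * Gamma (Complex (a + real d) t))"
  have g: "integrable lborel g" "(LINT t|lborel. g t) = of_real (2 * pi * exp (- (2 * x)))"
    unfolding g_def using a x by (intro mellin_inversion_Gamma; simp)+
  have f: "f = (\<lambda>t. of_real ((2 * x) ^ d) * g (0 + (-2) * t))"
  proof
    fix t
    define z where "z = Complex a (- 2 * t)"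
    have z: "Complex (a + real d) (0 + (-2) * t) = z + of_nat d"
      by (simp add: z_def complex_eq_iff)
    have "complex_of_real x powr (- z) * 2 powr (- z) = of_real (2 * x) powr (- z)"
      using x by (simp add: powr_times_real mult_ac)
    also have "complex_of_real (2 * x) powr (- z) = of_real (2 * x) powr (of_nat d + - (z + of_nat d))" by simp
    also have "\<dots> = of_real ((2 * x) ^ d) * of_real (2 * x) powr (- (z + of_nat d))"
      using x unfolding powr_add by (simp del: minus_add_distrib)
    finally show "f t = of_real ((2 * x) ^ d) * g (0 + (-2) * t)"
      unfolding f_def g_def z z_def[symmetric] by (simp only: mult_ac)
  qed
  show "integrable lborel f"
    unfolding f using g(1) by (intro integrable_mult_right lborel_integrable_real_affine) auto
  have "of_real (2 * pi * exp (- (2 * x))) = \<bar>-2\<bar> *\<^sub>R (LINT t|lborel. g (0 + (-2) * t))"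
    unfolding g(2)[symmetric] by (rule lborel_integral_real_affine) simp
  then have "(LINT t|lborel. g (0 + (-2) * t)) = of_real (pi * exp (- (2 * x)))"
    by (simp add: scaleR_conv_of_real)
  then show "(LINT t|lborel. f t) = of_real (pi * (2 * x) ^ d * exp (- 2 * x))"
    unfolding f by simp
qed

text \<open>The Pochhammer quotient of the kernel is inverse to that of the functional equation, and
  \<open>Gamma w\<close> cancels against \<open>rGamma w\<close>. The computation is multiplied by
  \<open>p\<close>, nonzero since \<open>w\<close> has positive real part, to avoid
  quotients.\<close>

lemma meijer_kernel_times_mellin:
  assumes M: "M \<ge> 0"
    and w: "w = 2 * s + of_real M + 2" "Re w > 0"
    and w': "w' = - 2 * s - 2 * of_nat l - 1" "Re w' > 0"
  shows "meijer_kernel l M s * (2 powr (- w) * Gamma w * weight_pochhammer l M j w)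
       = (-1) ^ j * (2 powr (- w') * Gamma w' * weight_pochhammer l M j w')"
proof -
  define p p' where "p = pochhammer ((w + 1) / 2) l" and "p' = pochhammer ((w' + 1) / 2) l"
  have p: "p \<noteq> 0" unfolding p_def using w(2) by (intro pochhammer_nonzero_if_Re_pos) simp
  have ker: "p * meijer_kernel l M s = p' * (2 powr (w - w') * Gamma w' * rGamma w)"
    unfolding p_def p'_def by (rule meijer_kernel_duplication[OF w w'])
  have fe: "p' * weight_pochhammer l M j w = (-1) ^ j * (p * weight_pochhammer l M j w')"
    unfolding p_def p'_def using w(1) w'(1) by (intro weight_pochhammer_functional_equation[OF M]) simp
  have "w \<notin> \<int>\<^sub>\<le>\<^sub>0" using w(2) by (rule Re_pos_notin_nonpos_Ints)
  then have G: "rGamma w * Gamma w = 1" by (simp add: rGamma_inverse_Gamma Gamma_eq_zero_iff)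
  have two: "2 powr (w - w') * 2 powr (- w) = (2 powr (- w') :: complex)"
    by (simp flip: powr_add)
  have "p * (meijer_kernel l M s * (2 powr (- w) * Gamma w * weight_pochhammer l M j w))
      = (p * meijer_kernel l M s) * (2 powr (- w) * Gamma w * weight_pochhammer l M j w)"
    by (simp only: mult.assoc)
  also have "\<dots> = (2 powr (w - w') * 2 powr (- w)) * Gamma w' * (rGamma w * Gamma w) * (p' * weight_pochhammer l M j w)"
    unfolding ker by (simp only: mult_ac)
  also have "\<dots> = p * ((-1) ^ j * (2 powr (- w') * Gamma w' * weight_pochhammer l M j w'))"
    unfolding two G fe by (simp add: mult_ac)
  finally show ?thesis using p by simp
qed

theorem meijer_Mpoly_integral:
  fixes l j N :: nat and M x c :: real
  defines "M \<equiv> 2 * real l + 1 + 2 * real N" and "c \<equiv> - (3 * real l / 4) - 1 / 2 - M / 8"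
  assumes x: "x > 0"
  shows "set_integrable lborel {0<..} (\<lambda>y. (LINT t|lborel. meijer_kernel l M (Complex c t) * of_real ((x * y)\<^sup>2) powr Complex c t)
            * of_real (Mpoly_weighted j M l y))" (is ?int)
    and "(LINT y:{0<..}|lborel. (LINT t|lborel. meijer_kernel l M (Complex c t) * of_real ((x * y)\<^sup>2) powr Complex c t)
            * of_real (Mpoly_weighted j M l y))
       = of_real ((-1) ^ j * pi * exp (- 2 * x) * x powr (- (2 * real l + 1)) * Mpoly j M l (4 * x))" (is "?l = ?r")
proof -
  let ?I = "{..l} \<times> {..j}"
  have M: "M \<ge> 0" by (simp add: M_def)
  define a where "a = M / 4 - real l / 2"
  have a: "a > 0" by (simp add: a_def M_def)
  have ker: "integrable lborel (\<lambda>t. meijer_kernel l M (Complex c t))"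
    by (rule meijer_kernel_integrable) (simp_all add: M_def c_def)
  have h: "set_integrable lborel {0<..} (\<lambda>y. y powr (2 * c) * Mpoly_weighted j M l y)"
  proof -
    \<comment> \<open>The real point \<open>s = c\<close> suffices, as the modulus of y^(2s) is
      constant along the contour.\<close>
    have "set_integrable lborel {0<..} (\<lambda>y. of_real y powr (2 * complex_of_real c) * of_real (Mpoly_weighted j M l y))"
      by (rule Mpoly_mellin_transform(1)[OF M refl]) (simp add: c_def M_def field_simps)
    then have "set_integrable lborel {0<..} (\<lambda>y. complex_of_real (y powr (2 * c) * Mpoly_weighted j M l y))"
      by (rule set_integrable_cong[THEN iffD1, rotated -1]) (auto simp flip: powr_of_real)
    then show ?thesis unfolding complex_of_real_integrable_eq[symmetric] set_integrable_def by (simp add: scaleR_conv_of_real)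
  qed
  show ?int by (rule mellin_barnes_fubini(1)[OF ker x h])
  define u where "u = (\<lambda>t. Complex a (- 2 * t))"
  have pointwise: "meijer_kernel l M (Complex c t) * of_real x powr (2 * Complex c t)
           * (LINT y:{0<..}|lborel. of_real y powr (2 * Complex c t) * of_real (Mpoly_weighted j M l y))
       = (\<Sum>i\<in>?I. of_real ((-1) ^ j * Mpoly_const j M l * x powr (- (2 * real l + 1)) * gen_weight l M j i)
           * (of_real x powr (- u t) * 2 powr (- u t) * Gamma (u t + of_nat (fst i + snd i))))" for t
  proof -
    define s where "s = Complex c t"
    define w where "w = 2 * s + of_real M + 2"
    have w: "Re w > 0" by (simp add: w_def s_def c_def M_def field_simps)
    have u: "u t = - 2 * s - 2 * of_nat l - 1"
      by (simp add: u_def s_def complex_eq_iff a_def c_def field_simps)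
    have Re_u: "Re (u t) > 0" using a by (simp add: u_def)
    have "u t \<notin> \<int>\<^sub>\<le>\<^sub>0" using Re_u by (rule Re_pos_notin_nonpos_Ints)
    then have G: "Gamma (u t) * pochhammer (u t) n = Gamma (u t + of_nat n)" for n
      by (subst pochhammer_Gamma) (simp_all add: Gamma_eq_zero_iff)
    \<comment> \<open>Because 2s = -(2l+1) - w', the power of \<open>x\<close> in the result splits
      off here and leaves the kernel of Mellin inversion in \<open>w'\<close>.\<close>
    have x_powr: "complex_of_real x powr (2 * s) = of_real (x powr (- (2 * real l + 1))) * of_real x powr (- u t)"
    proof -
      have "2 * s = of_real (- (2 * real l + 1)) + - u t" by (simp add: u)
      then show ?thesis using x by (simp only: powr_add powr_of_real[OF less_imp_le])
    qed
    have "meijer_kernel l M s * of_real x powr (2 * s)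
           * (LINT y:{0<..}|lborel. of_real y powr (2 * s) * of_real (Mpoly_weighted j M l y))
        = of_real (Mpoly_const j M l) * of_real x powr (2 * s) * (meijer_kernel l M s * (2 powr (- w) * Gamma w * weight_pochhammer l M j w))"
      unfolding Mpoly_mellin_transform(2)[OF M w_def w] by (simp only: mult_ac)
    also have "\<dots> = of_real (Mpoly_const j M l) * of_real x powr (2 * s) * ((-1) ^ j * (2 powr (- u t) * Gamma (u t) * weight_pochhammer l M j (u t)))"
      unfolding meijer_kernel_times_mellin[OF M w_def w u Re_u] ..
    also have "\<dots> = (\<Sum>i\<in>?I. of_real ((-1) ^ j * Mpoly_const j M l * x powr (- (2 * real l + 1)) * gen_weight l M j i)
           * (of_real x powr (- u t) * 2 powr (- u t) * Gamma (u t + of_nat (fst i + snd i))))"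
      unfolding weight_pochhammer_def sum_distrib_left x_powr G[symmetric]
      by (intro sum.cong refl) (simp only: of_real_mult of_real_power of_real_minus of_real_1 mult_ac)
    finally show ?thesis unfolding s_def .
  qed
  have "?l = (LINT t|lborel. meijer_kernel l M (Complex c t) * of_real x powr (2 * Complex c t)
           * (LINT y:{0<..}|lborel. of_real y powr (2 * Complex c t) * of_real (Mpoly_weighted j M l y)))"
    by (rule mellin_barnes_fubini(2)[OF ker x h])
  \<comment> \<open>The sum is finite, so inversion applies to each shifted Gamma function
    separately; the powers of \<open>2 * x\<close> then recombine to the polynomial at
    \<open>4 * x\<close>.\<close>
  also have "\<dots> = (\<Sum>i\<in>?I. of_real ((-1) ^ j * Mpoly_const j M l * x powr (- (2 * real l + 1)) * gen_weight l M j i)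
           * of_real (pi * (2 * x) ^ (fst i + snd i) * exp (- 2 * x)))"
    unfolding pointwise u_def
    by (subst Bochner_Integration.integral_sum)
       (auto simp only: integral_mult_right_zero mellin_inversion_shifted_Gamma[OF a x] intro!: integrable_mult_right)
  also have "\<dots> = ?r"
    unfolding Mpoly_eq_sum_weight[OF M x] sum_distrib_left of_real_sum of_real_mult[symmetric]
    by (intro sum.cong refl arg_cong[of _ _ of_real]) (simp only: mult_ac)
  finally show "?l = ?r" .
qed

theorem theorem2p8:
  fixes l j :: nat and mu :: int and x :: real
  assumes "odd mu" and "mu \<ge> 2 * int l + 1" and "x > 0"
  shows "set_integrable lborel {0<..}
           (\<lambda>y. meijerG20_04 ((x * y)^2) 0 (- real l - 1/2) (- real_of_int mu / 2)
                   (- real l - (real_of_int mu + 1) / 2)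
                 * complex_of_real (exp (- 2 * y) * y powr (real_of_int mu + 1)
                                    * Mpoly j (real_of_int mu) l (4 * y)))
       \<and> (LINT y:{0<..}|lborel.
             meijerG20_04 ((x * y)^2) 0 (- real l - 1/2) (- real_of_int mu / 2)
                   (- real l - (real_of_int mu + 1) / 2)
             * complex_of_real (exp (- 2 * y) * y powr (real_of_int mu + 1)
                                * Mpoly j (real_of_int mu) l (4 * y)))
         = complex_of_real ((-1) ^ j / 2 * exp (- 2 * x) * x powr (- (2 * real l + 1))
                            * Mpoly j (real_of_int mu) l (4 * x))"
proof -
  obtain k where k: "mu = 2 * k + 1" using \<open>odd mu\<close> by (rule oddE)
  \<comment> \<open>That is, \<open>N = (mu - 1) / 2 - l\<close>; the lower bound on
    \<open>mu\<close> ensures that \<open>nat\<close> does not truncate.\<close>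
  define N where "N = nat (k - int l)"
  define M where "M = real_of_int mu"
  define c where "c = - (3 * real l / 4) - 1 / 2 - M / 8"
  have "k = int l + int N" using k assms(2) by (simp add: N_def)
  then have M: "M = 2 * real l + 1 + 2 * real N" by (simp add: M_def k)
  define L where "L = (\<lambda>y. LINT t|lborel. meijer_kernel l M (Complex c t) * of_real ((x * y)\<^sup>2) powr Complex c t)"
  \<comment> \<open>The minimum is attained by the second parameter,
    \<open>- l - 1/2\<close>.\<close>
  have "(min 0 (- real l - 1/2) + (0 + (- real l - 1/2) + (- M / 2) + (- real l - (M + 1) / 2) - 1) / 4) / 2 = c"
    by (simp add: c_def min_def field_simps)
  then have G: "meijerG20_04 ((x * y)^2) 0 (- real l - 1/2) (- M / 2) (- real l - (M + 1) / 2) = L y / of_real (2 * pi)" for y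
    unfolding meijerG20_04_def meijerG20_04_line_def L_def meijer_kernel_def Let_def by (simp only: of_real_0 diff_0)
  have int: "set_integrable lborel {0<..} (\<lambda>y. L y * of_real (Mpoly_weighted j M l y))"
    and val: "(LINT y:{0<..}|lborel. L y * of_real (Mpoly_weighted j M l y))
       = of_real ((-1) ^ j * pi * exp (- 2 * x) * x powr (- (2 * real l + 1)) * Mpoly j M l (4 * x))"
    using meijer_Mpoly_integral[where l = l and N = N and j = j, OF \<open>x > 0\<close>] unfolding L_def M c_def by blast+
  \<comment> \<open>The factor \<open>1 / (2 * pi)\<close> of the Mellin-Barnes integral meets the
    \<open>pi\<close> from the inversion, which accounts for the \<open>1 / 2\<close> in the
    result.\<close>
  have eq: "L y / of_real (2 * pi) * of_real (Mpoly_weighted j M l y)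
      = of_real (1 / (2 * pi)) * (L y * of_real (Mpoly_weighted j M l y))" for y
    by simp
  show ?thesis
    unfolding M_def[symmetric] G Mpoly_weighted_def[symmetric] eq
    using int by (auto intro!: set_integrable_mult_right simp: val)
qed

end
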